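(* Let $0<a<1$, let $C_a$ be the Chebyshev's method of $p_a(z)=(z^2-1)(z^2-a)$, and let $a_1$ be the largest positive extraneous fixed point of $C_a$. The immediate basins $\mathcal A_{-1}$ and $\mathcal A_{1}$ contain $(-\infty,-a_1)$ and $(a_1,\infty)$ respectively. In particular, these are unbounded and their respective boundaries contain a pole of $C_a$.
   Context: For a polynomial $p$, the Chebyshev's method of $p$ is the rational map $C_p(z)=z-\left[1+\frac12 L_p(z)\right]\frac{p(z)}{p'(z)}$ with $L_p(z)=\frac{p(z)p''(z)}{(p'(z))^2}$, regarded as a self-map of the Riemann sphere $\widehat{\mathbb C}$. For $p_a(z)=(z^2-1)(z^2-a)$ write $C_a:=C_{p_a}$. The roots $\pm1,\pm\sqrt a$ of $p_a$ are superattracting fixed points of $C_a$; for such a root $\zeta$, $\mathcal A_\zeta$ denotes its immediate basin, i.e. the Fatou component of $C_a$ containing $\zeta$. The extraneous fixed points of $C_a$ are the finite fixed points that are not roots of $p_a$; for $0<a<1$ they are six real numbers $\pm a_1,\pm a_2,\pm a_3$ with $0<a_3<\sqrt a<a_2<\sqrt{(a+1)/2}<a_1<1$. A pole of $C_a$ is a point of $\mathbb C$ mapped by $C_a$ to $\infty$; the poles are $0$ and $\pm\sqrt{(a+1)/2}$. *)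

theory Defs
  imports "HOL-Analysis.Analysis" "HOL-Computational_Algebra.Polynomial"
begin

datatype riemann_sphere = Fin complex | Infty

text \<open>Stereographic projection onto the unit sphere of \<open>\<complex> \<times> \<real>\<close>; the distance it induces is
  the chordal metric.\<close>

fun stereo :: "riemann_sphere \<Rightarrow> complex \<times> real" where
  "stereo (Fin z) = (complex_of_real (2 / ((cmod z)\<^sup>2 + 1)) * z, ((cmod z)\<^sup>2 - 1) / ((cmod z)\<^sup>2 + 1))"
| "stereo Infty = (0, 1)"

lemma inj_stereo: "inj stereo"
proof -
  have pos: "(cmod z)\<^sup>2 + 1 > 0" for z
    by (smt (verit) zero_le_power2)
  have snd_eq: "snd (stereo (Fin z)) = 1 - 2 / ((cmod z)\<^sup>2 + 1)" for z
    using pos[of z] by (simp add: field_simps)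
  have ne: "stereo (Fin z) \<noteq> stereo Infty" for z
  proof
    assume "stereo (Fin z) = stereo Infty"
    then have "2 / ((cmod z)\<^sup>2 + 1) = 0"
      using snd_eq[of z] by simp
    with pos[of z] show False by simp
  qed
  have eq: "z = w" if "stereo (Fin z) = stereo (Fin w)" for z w
  proof -
    have h: "2 / ((cmod z)\<^sup>2 + 1) = 2 / ((cmod w)\<^sup>2 + 1)"
      using arg_cong[OF that, of snd] snd_eq by simp
    have "complex_of_real (2 / ((cmod z)\<^sup>2 + 1)) * z = complex_of_real (2 / ((cmod w)\<^sup>2 + 1)) * w"
      using that by (simp only: stereo.simps prod.inject)
    then have "complex_of_real (2 / ((cmod w)\<^sup>2 + 1)) * z = complex_of_real (2 / ((cmod w)\<^sup>2 + 1)) * w"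
      by (simp only: h)
    moreover have "complex_of_real (2 / ((cmod w)\<^sup>2 + 1)) \<noteq> 0"
      using pos[of w] by (simp only: of_real_eq_0_iff) simp
    ultimately show ?thesis by (metis mult_left_cancel)
  qed
  show ?thesis
  proof (rule injI)
    fix x y assume "stereo x = stereo y"
    then show "x = y"
      by (cases x; cases y) (use ne eq in \<open>metis\<close>)+
  qed
qed

instantiation riemann_sphere :: metric_space
begin

definition dist_riemann_sphere :: "riemann_sphere \<Rightarrow> riemann_sphere \<Rightarrow> real" where
  "dist_riemann_sphere x y = dist (stereo x) (stereo y)"

definition uniformity_riemann_sphere :: "(riemann_sphere \<times> riemann_sphere) filter" where
  "uniformity_riemann_sphere = (INF e\<in>{0<..}. principal {(x, y). dist x y < e})"

definition open_riemann_sphere :: "riemann_sphere set \<Rightarrow> bool" where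
  "open_riemann_sphere U \<longleftrightarrow> (\<forall>x\<in>U. eventually (\<lambda>(x', y). x' = x \<longrightarrow> y \<in> U) uniformity)"

instance
proof
  fix x y z :: riemann_sphere
  show "dist x y = 0 \<longleftrightarrow> x = y"
    using inj_stereo by (auto simp: dist_riemann_sphere_def inj_eq)
  show "dist x y \<le> dist x z + dist y z"
    by (simp add: dist_riemann_sphere_def dist_triangle2)
qed (simp_all only: uniformity_riemann_sphere_def open_riemann_sphere_def)

end

text \<open>The value at \<open>x\<close> is taken as the limit over the punctured neighbourhood of \<open>x\<close>. If \<open>g\<close> is the
  evaluation of a quotient of polynomials, this is the associated rational self-map of the sphere:
  poles, removable singularities and the point at infinity are all covered by the limit, and the
  values of \<open>g\<close> at the zeros of a denominator as well as the dummy value at \<open>Infty\<close> play no role.\<close>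

definition sphere_extension :: "(complex \<Rightarrow> complex) \<Rightarrow> riemann_sphere \<Rightarrow> riemann_sphere" where
  "sphere_extension g x = Lim (at x) (\<lambda>w. case w of Fin z \<Rightarrow> Fin (g z) | Infty \<Rightarrow> Infty)"

definition L_fun :: "complex poly \<Rightarrow> complex \<Rightarrow> complex" where
  "L_fun p z = poly p z * poly (pderiv (pderiv p)) z / (poly (pderiv p) z)\<^sup>2"

definition chebyshev_method :: "complex poly \<Rightarrow> riemann_sphere \<Rightarrow> riemann_sphere" where
  "chebyshev_method p =
     sphere_extension (\<lambda>z. z - (1 + L_fun p z / 2) * (poly p z / poly (pderiv p) z))"

definition extraneous_fixed_points :: "complex poly \<Rightarrow> complex set" where
  "extraneous_fixed_points p = {z. chebyshev_method p (Fin z) = Fin z \<and> poly p z \<noteq> 0}"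

definition poles :: "(riemann_sphere \<Rightarrow> riemann_sphere) \<Rightarrow> complex set" where
  "poles f = {z. f (Fin z) = Infty}"

definition normal_family :: "('a::metric_space \<Rightarrow> 'b::metric_space) set \<Rightarrow> 'a set \<Rightarrow> bool" where
  "normal_family F U \<longleftrightarrow>
     (\<forall>f :: nat \<Rightarrow> 'a \<Rightarrow> 'b. range f \<subseteq> F \<longrightarrow>
       (\<exists>r g. strict_mono r \<and>
         (\<forall>K. compact K \<and> K \<subseteq> U \<longrightarrow> uniform_limit K (\<lambda>n. f (r n)) g sequentially)))"

definition fatou_set :: "('a::metric_space \<Rightarrow> 'a) \<Rightarrow> 'a set" where
  "fatou_set f = {x. \<exists>U. open U \<and> x \<in> U \<and> normal_family (range (\<lambda>n. f ^^ n)) U}"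

text \<open>For a superattracting fixed point \<open>x\<close>.\<close>

definition immediate_basin :: "('a::metric_space \<Rightarrow> 'a) \<Rightarrow> 'a \<Rightarrow> 'a set" where
  "immediate_basin f x = connected_component_set (fatou_set f) x"

definition p_poly :: "real \<Rightarrow> complex poly" where
  "p_poly a = [:-1, 0, 1:] * [:- complex_of_real a, 0, 1:]"

end

theory Submission
  imports Defs "HOL-Complex_Analysis.Conformal_Mappings" "HOL-Real_Asymp.Real_Asymp"
begin

text \<open>On the real line \<open>C\<^sub>a\<close> is increasing to the right of its largest pole, and \<open>a\<^sub>1\<close> is its last fixed
  point before \<open>1\<close>, so all orbits starting in \<open>(a\<^sub>1, \<infinity>)\<close> converge monotonically to \<open>1\<close>; this gives the
  ray in the basin. For the pole on the boundary, consider the values \<open>w > 1\<close> that have a non-real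
  preimage in the component of the basin containing \<open>1\<close>. They exist because \<open>C\<^sub>a\<close> is locally three-to-one
  at \<open>1\<close>, they form an open set by the open mapping theorem, and they form a closed set because \<open>C\<^sub>a\<close>
  commutes with conjugation: where \<open>C\<^sub>a\<close> is locally injective at a real point, a nearby preimage of a
  real value is its own conjugate. Hence every \<open>w > 1\<close> has such a preimage. As \<open>w \<rightarrow> \<infinity>\<close> the preimages stay
  bounded, since \<open>C\<^sub>a\<close> is also injective near \<open>\<infinity>\<close>, so they accumulate at a pole. That pole is not in
  the Fatou set: a limit function of the iterates would take the value \<open>\<infinity>\<close> there and the value \<open>1\<close> at
  points of the basin arbitrarily close to it. The basin of \<open>-1\<close> is the mirror image, as \<open>C\<^sub>a\<close> is odd.\<close>

section \<open>The topology of the sphere\<close>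

lemma tendsto_stereo: "(stereo \<longlongrightarrow> stereo x) (nhds x)"
  unfolding tendsto_iff dist_riemann_sphere_def[symmetric]
  by (auto simp: eventually_nhds_metric dist_commute)

lemma tendsto_sphere_iff: "(f \<longlongrightarrow> (l::riemann_sphere)) F \<longleftrightarrow> ((\<lambda>x. stereo (f x)) \<longlongrightarrow> stereo l) F"
  by (simp add: tendsto_iff dist_riemann_sphere_def)

lemma snd_stereo_Fin: "snd (stereo (Fin z)) = 1 - 2 / ((cmod z)\<^sup>2 + 1)"
proof -
  have "(cmod z)\<^sup>2 + 1 > 0" by (smt (verit) zero_le_power2)
  then show ?thesis by (simp add: field_simps)
qed

text \<open>Stereographic projection back from the pole \<open>(0, 1)\<close> to the plane: the
  inverse of \<open>stereo\<close> on finite points. At \<open>Infty\<close> the quotient is 0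
  divided by 0, hence 0.\<close>

definition unstereo :: "riemann_sphere \<Rightarrow> complex" where
  "unstereo x = fst (stereo x) / of_real (1 - snd (stereo x))"

lemma unstereo_Fin [simp]: "unstereo (Fin z) = z"
proof -
  have "(cmod z)\<^sup>2 + 1 > 0" by (smt (verit) zero_le_power2)
  then have "complex_of_real (2 / ((cmod z)\<^sup>2 + 1)) \<noteq> 0" by (simp only: of_real_eq_0_iff) simp
  moreover have "fst (stereo (Fin z)) = complex_of_real (2 / ((cmod z)\<^sup>2 + 1)) * z"
    by simp
  ultimately show ?thesis
    unfolding unstereo_def snd_stereo_Fin by simp
qed

lemma eventually_Fin: "\<forall>\<^sub>F x in nhds (Fin z). x = Fin (unstereo x)"
proof -
  have "Fin z \<in> - {Infty}" "open (- {Infty})" by auto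
  then have "\<forall>\<^sub>F x in nhds (Fin z). x \<in> - {Infty}" by (metis eventually_nhds)
  then show ?thesis
    by (rule eventually_mono) (metis ComplD insertI1 riemann_sphere.exhaust unstereo_Fin)
qed

text \<open>\<open>Fin\<close> is an open embedding: one inequality is its continuity, the other the
  continuity of \<open>unstereo\<close>, which inverts it near any finite point.\<close>

lemma nhds_Fin: "nhds (Fin z) = filtermap Fin (nhds z)"
proof (rule antisym)
  have pos: "(cmod w)\<^sup>2 + 1 \<noteq> 0" for w by (smt (verit) zero_le_power2)
  have "((\<lambda>w. stereo (Fin w)) \<longlongrightarrow> stereo (Fin z)) (nhds z)"
    unfolding stereo.simps by (intro tendsto_intros filterlim_ident pos)
  then show "filtermap Fin (nhds z) \<le> nhds (Fin z)"
    unfolding tendsto_sphere_iff[symmetric] unfolding filterlim_def .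
  have "1 - snd (stereo (Fin z)) \<noteq> 0"
    unfolding snd_stereo_Fin using pos by auto
  then have "(unstereo \<longlongrightarrow> unstereo (Fin z)) (nhds (Fin z))"
    unfolding unstereo_def by (intro tendsto_intros tendsto_stereo) auto
  then have "filtermap unstereo (nhds (Fin z)) \<le> nhds z"
    by (simp add: filterlim_def)
  then have "filtermap Fin (filtermap unstereo (nhds (Fin z))) \<le> filtermap Fin (nhds z)"
    by (rule filtermap_mono)
  moreover have "filtermap Fin (filtermap unstereo (nhds (Fin z))) = nhds (Fin z)"
    unfolding filtermap_filtermap filter_eq_iff eventually_filtermap
    by (intro allI eventually_subst eventually_mono[OF eventually_Fin]) simp
  ultimately show "nhds (Fin z) \<le> filtermap Fin (nhds z)" by simp
qed

lemma tendsto_Fin_iff: "((\<lambda>x. Fin (f x)) \<longlongrightarrow> Fin l) F \<longleftrightarrow> (f \<longlongrightarrow> l) F"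
  unfolding nhds_Fin filterlim_def filtermap_filtermap[symmetric, of Fin f]
  by (rule filtermap_mono_strong) (simp add: inj_def)

lemma at_Fin: "at (Fin z) = filtermap Fin (at z)"
  by (rule filter_eqI) (simp add: eventually_at_filter nhds_Fin eventually_filtermap)

text \<open>Chordal neighbourhoods of \<open>Infty\<close> are the complements of discs: the
  stereographic image tends to \<open>(0, 1)\<close> as the modulus grows, and conversely the height
  is an increasing function of the modulus, so a height near 1 forces a large modulus.\<close>

lemma at_Infty: "at Infty = filtermap Fin at_infinity"
proof (rule antisym)
  have "((\<lambda>z. cmod (fst (stereo (Fin z)))) \<longlongrightarrow> 0) at_infinity"
  proof -
    have "((\<lambda>t::real. 2 * t / (t\<^sup>2 + 1)) \<longlongrightarrow> 0) at_top" by real_asymp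
    from filterlim_compose[OF this filterlim_norm_at_top]
    show ?thesis by (simp add: norm_mult norm_divide del: of_real_divide)
  qed
  moreover have "((\<lambda>z. snd (stereo (Fin z))) \<longlongrightarrow> 1) at_infinity"
  proof -
    have "((\<lambda>t::real. (t\<^sup>2 - 1) / (t\<^sup>2 + 1)) \<longlongrightarrow> 1) at_top" by real_asymp
    from filterlim_compose[OF this filterlim_norm_at_top]
    show ?thesis by simp
  qed
  ultimately have "((\<lambda>z. (fst (stereo (Fin z)), snd (stereo (Fin z)))) \<longlongrightarrow> (0, 1)) at_infinity"
    by (intro tendsto_Pair) (simp_all only: tendsto_norm_zero_iff)
  then have "(Fin \<longlongrightarrow> Infty) at_infinity"
    by (simp add: tendsto_sphere_iff del: stereo.simps(1))
  then have "filterlim Fin (at Infty) at_infinity"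
    by (simp add: filterlim_at)
  then show "filtermap Fin at_infinity \<le> at Infty"
    by (simp add: filterlim_def)
  show "at Infty \<le> filtermap Fin at_infinity"
  proof (rule filter_leI)
    fix P assume "eventually P (filtermap Fin at_infinity)"
    then obtain b where b: "\<And>z. b \<le> cmod z \<Longrightarrow> P (Fin z)"
      by (auto simp: eventually_filtermap eventually_at_infinity)
    have "((\<lambda>x. snd (stereo x)) \<longlongrightarrow> 1) (nhds Infty)"
      using tendsto_snd[OF tendsto_stereo[of Infty]] by simp
    \<comment> \<open>The threshold is the height of the points of modulus
      \<open>\<bar>b\<bar>\<close>; the given \<open>b\<close> may be negative.\<close>
    moreover have "1 - 2 / (b\<^sup>2 + 1) < 1"
      by (smt (verit) divide_pos_pos zero_le_power2)
    ultimately have "\<forall>\<^sub>F x in nhds Infty. 1 - 2 / (b\<^sup>2 + 1) < snd (stereo x)"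
      by (rule order_tendstoD)
    then show "eventually P (at Infty)"
      unfolding eventually_at_filter
    proof (rule eventually_mono, intro impI)
      fix x assume *: "1 - 2 / (b\<^sup>2 + 1) < snd (stereo x)" and "x \<noteq> Infty"
      then obtain z where x: "x = Fin z" by (cases x) auto
      have pos: "b\<^sup>2 + 1 > 0" "(cmod z)\<^sup>2 + 1 > 0" by (smt (verit) zero_le_power2)+
      have "2 / ((cmod z)\<^sup>2 + 1) < 2 / (b\<^sup>2 + 1)"
        using * unfolding x snd_stereo_Fin by simp
      then have "b\<^sup>2 < (cmod z)\<^sup>2" using pos by (simp add: field_simps)
      then have "b \<le> cmod z" by (smt (verit) norm_ge_zero power_mono)
      then show "P x" using b x by simp
    qed
  qed
qed

lemma tendsto_Fin_Infty: "filterlim f at_infinity F \<Longrightarrow> ((\<lambda>x. Fin (f x)) \<longlongrightarrow> Infty) F"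
  by (metis at_Infty filterlim_at filterlim_compose filterlim_def order_refl)

text \<open>The sphere has no isolated points, so limits over punctured neighbourhoods are unique
  and the \<open>Lim\<close> in \<open>sphere_extension\<close> is determined by any limit
  exhibited.\<close>

lemma at_sphere_neq_bot: "at (x :: riemann_sphere) \<noteq> bot"
  using trivial_limit_at_infinity[where 'a = complex]
  by (cases x) (simp_all add: at_Fin at_Infty filtermap_bot_iff)

section \<open>Evaluating the extension of a plane map to the sphere\<close>

lemma sphere_extension_eqI:
  assumes "((\<lambda>w. case w of Fin z \<Rightarrow> Fin (g z) | Infty \<Rightarrow> Infty) \<longlongrightarrow> l) (at x)"
  shows "sphere_extension g x = l"
  unfolding sphere_extension_def by (intro tendsto_Lim at_sphere_neq_bot assms)

lemma sphere_extension_Fin: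
  assumes "(g \<longlongrightarrow> l) (at z)" shows "sphere_extension g (Fin z) = Fin l"
  by (rule sphere_extension_eqI) (simp add: at_Fin filterlim_filtermap tendsto_Fin_iff assms)

lemma sphere_extension_pole:
  assumes "filterlim g at_infinity (at z)" shows "sphere_extension g (Fin z) = Infty"
  by (rule sphere_extension_eqI) (simp add: at_Fin filterlim_filtermap tendsto_Fin_Infty assms)

lemma sphere_extension_Infty:
  assumes "filterlim g at_infinity at_infinity" shows "sphere_extension g Infty = Infty"
  by (rule sphere_extension_eqI) (simp add: at_Infty filterlim_filtermap tendsto_Fin_Infty assms)

lemma open_Fin_image:
  assumes "open S" shows "open (Fin ` S)"
proof (rule open_subopen[THEN iffD2], rule ballI)
  fix x assume "x \<in> Fin ` S"
  then obtain z where x: "x = Fin z" and "z \<in> S" by blast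
  have "\<forall>\<^sub>F y in nhds x. y \<in> Fin ` S"
    unfolding x nhds_Fin eventually_filtermap using eventually_nhds_in_open[OF assms \<open>z \<in> S\<close>]
    by (rule eventually_mono) simp
  from this[unfolded eventually_nhds]
  obtain T where "open T" "x \<in> T" "\<forall>y\<in>T. y \<in> Fin ` S" by (elim exE conjE)
  then show "\<exists>T. open T \<and> x \<in> T \<and> T \<subseteq> Fin ` S"
    by (intro exI[of _ T] conjI subsetI) simp_all
qed

lemma isCont_Fin: "isCont Fin z"
  using tendsto_Fin_iff[of "\<lambda>x. x" z "at z"] by (simp add: isCont_def)

lemma connected_Fin_image: "connected S \<Longrightarrow> connected (Fin ` S)"
  by (intro connected_continuous_image continuous_at_imp_continuous_on ballI isCont_Fin)

section \<open>Chebyshev's method of the quartic\<close>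

text \<open>The polynomial and its first two derivatives are written over an arbitrary real normed
  field: the real instance serves the monotone dynamics, the complex one the topology of the
  basin.\<close>

definition quartic :: "real \<Rightarrow> 'a::real_normed_field \<Rightarrow> 'a" where
  "quartic a z = (z\<^sup>2 - 1) * (z\<^sup>2 - of_real a)"

definition quartic' :: "real \<Rightarrow> 'a::real_normed_field \<Rightarrow> 'a" where
  "quartic' a z = 2 * z * (2 * z\<^sup>2 - of_real (1 + a))"

definition quartic'' :: "real \<Rightarrow> 'a::real_normed_field \<Rightarrow> 'a" where
  "quartic'' a z = 12 * z\<^sup>2 - of_real (2 * (1 + a))"

text \<open>Since \<open>cheb a z - z\<close> is
  \<open>- quartic a z * cheb_factor a z / (2 * quartic' a z ^ 3)\<close>, the extraneous fixed
  points are zeros of this factor.\<close>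

definition cheb_factor :: "real \<Rightarrow> 'a::real_normed_field \<Rightarrow> 'a" where
  "cheb_factor a z = 2 * (quartic' a z)\<^sup>2 + quartic a z * quartic'' a z"

text \<open>Written over one denominator, so that a zero of \<open>quartic'\<close> is seen to be a
  pole from the nonvanishing of the numerator. The value there is 0, by division by zero.\<close>

definition cheb :: "real \<Rightarrow> 'a::real_normed_field \<Rightarrow> 'a" where
  "cheb a z = (2 * z * quartic' a z ^ 3 - quartic a z * cheb_factor a z) / (2 * quartic' a z ^ 3)"

lemma poly_p_poly: "poly (p_poly a) z = quartic a z"
  by (simp add: p_poly_def quartic_def power2_eq_square algebra_simps)

lemma poly_pderiv_p_poly: "poly (pderiv (p_poly a)) z = quartic' a z"
  by (simp add: p_poly_def quartic'_def power2_eq_square pderiv_mult pderiv_pCons algebra_simps)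

lemma poly_pderiv2_p_poly: "poly (pderiv (pderiv (p_poly a))) z = quartic'' a z"
  by (simp add: p_poly_def quartic''_def power2_eq_square pderiv_mult pderiv_pCons pderiv_add algebra_simps)

lemma cheb_eq:
  assumes "quartic' a z \<noteq> 0"
  shows "cheb a z = z - quartic a z * cheb_factor a z / (2 * quartic' a z ^ 3)"
  using assms by (simp add: cheb_def diff_divide_distrib)

lemma chebyshev_iteration_eq:
  assumes "quartic' a z \<noteq> 0"
  shows "z - (1 + L_fun (p_poly a) z / 2) * (poly (p_poly a) z / poly (pderiv (p_poly a)) z) = cheb a z"
  unfolding cheb_eq[OF assms] L_fun_def poly_p_poly poly_pderiv_p_poly poly_pderiv2_p_poly cheb_factor_def
  using assms by (simp add: field_simps power2_eq_square power3_eq_cube)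

lemma of_real_quartic: "of_real (quartic a x) = quartic a (of_real x)"
  by (simp add: quartic_def)

lemma of_real_quartic': "of_real (quartic' a x) = quartic' a (of_real x)"
  by (simp add: quartic'_def)

lemma of_real_quartic'': "of_real (quartic'' a x) = quartic'' a (of_real x)"
  by (simp add: quartic''_def)

lemma of_real_cheb_factor: "of_real (cheb_factor a x) = cheb_factor a (of_real x)"
  by (simp add: cheb_factor_def of_real_quartic of_real_quartic' of_real_quartic'')

lemma of_real_cheb: "of_real (cheb a x) = cheb a (of_real x)"
  by (simp add: cheb_def of_real_quartic of_real_quartic' of_real_cheb_factor)

lemma cnj_cheb: "cnj (cheb a z) = cheb a (cnj z)"
  by (simp add: cheb_def cheb_factor_def quartic_def quartic'_def quartic''_def)

lemma quartic'_minus: "quartic' a (- z) = - quartic' a z"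
  by (simp add: quartic'_def)

lemma cheb_minus: "cheb a (- z) = - cheb a z"
proof -
  have "(- quartic' a z) ^ 3 = - (quartic' a z ^ 3)" by simp
  then show ?thesis
    by (simp add: cheb_def cheb_factor_def quartic_def quartic'_minus quartic''_def
        flip: minus_divide_left)
qed

text \<open>With p the quartic, the derivative is p^2 (3 p''^2 - p' p''') / (2 p'^4). Here the
  bracket becomes a sum of squares, positive at every nonzero real point, so the only real critical
  points away from the poles are the roots of p.\<close>

lemma DERIV_cheb:
  fixes z :: "'a::real_normed_field"
  assumes "quartic' a z \<noteq> 0"
  shows "(cheb a has_field_derivative
    6 * (quartic a z)\<^sup>2 * (12 * z^4 + (4 * z\<^sup>2 - of_real (1 + a))\<^sup>2) / quartic' a z ^ 4) (at z)"
proof -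
  define k where "k = 12 * z^4 + (4 * z\<^sup>2 - of_real (1 + a))\<^sup>2"
  have d0: "(quartic a has_field_derivative quartic' a z) (at z)"
    unfolding quartic_def quartic'_def
    by (auto intro!: derivative_eq_intros simp: algebra_simps power2_eq_square)
  have d1: "(quartic' a has_field_derivative quartic'' a z) (at z)"
    unfolding quartic'_def quartic''_def
    by (auto intro!: derivative_eq_intros simp: algebra_simps power2_eq_square)
  have d2: "(quartic'' a has_field_derivative 24 * z) (at z)"
    unfolding quartic''_def by (auto intro!: derivative_eq_intros)
  have "(cheb a has_field_derivative
      (quartic a z)\<^sup>2 * (3 * (quartic'' a z)\<^sup>2 - quartic' a z * (24 * z)) / (2 * quartic' a z ^ 4)) (at z)"
    unfolding cheb_def[abs_def] cheb_factor_def
    apply (rule derivative_eq_intros d0 d1 d2 refl | use assms in simp; fail)+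
    using assms apply (simp add: divide_simps)
    apply (simp add: algebra_simps eval_nat_numeral)
    done
  also have "3 * (quartic'' a z)\<^sup>2 - quartic' a z * (24 * z)
      = 12 * k"
    by (simp add: k_def quartic'_def quartic''_def algebra_simps power2_eq_square power4_eq_xxxx)
  finally show ?thesis unfolding k_def[symmetric] by (rule DERIV_cong) simp
qed

text \<open>Substituting \<open>p = (z - 1) q\<close> cancels three factors \<open>z - 1\<close> from \<open>C\<^sub>a(z) - 1\<close>.\<close>

definition cheb_cofactor :: "real \<Rightarrow> 'a::real_normed_field \<Rightarrow> 'a" where
  "cheb_cofactor a z =
    (let q = (z + 1) * (z\<^sup>2 - of_real a); q' = 3 * z\<^sup>2 + 2 * z - of_real a; q'' = 6 * z + 2
     in (4 * q * q'\<^sup>2 + 2 * (z - 1) * q' ^ 3 - q\<^sup>2 * q'') / (2 * quartic' a z ^ 3))"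

text \<open>The exponent 3 is the cubic convergence of the method at the simple root 1. It gives
  both the contraction near 1 and the local cube root used to find non-real preimages.\<close>

lemma cheb_minus_1:
  assumes "quartic' a z \<noteq> 0"
  shows "cheb a z - 1 = (z - 1) ^ 3 * cheb_cofactor a z"
proof -
  define q where "q = (z + 1) * (z\<^sup>2 - of_real a)"
  define q' where "q' = 3 * z\<^sup>2 + 2 * z - of_real a"
  define q'' where "q'' = 6 * z + 2"
  define t where "t = z - 1"
  have z: "z = 1 + t" by (simp add: t_def)
  have p: "quartic a z = t * q"
    by (simp add: quartic_def q_def t_def power2_eq_square algebra_simps)
  have p': "quartic' a z = q + t * q'"
    by (simp add: quartic'_def q_def q'_def t_def power2_eq_square algebra_simps)
  have p'': "quartic'' a z = 2 * q' + t * q''"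
    by (simp add: quartic''_def q''_def q'_def t_def power2_eq_square algebra_simps)
  have nz: "q + t * q' \<noteq> 0" using assms p' by simp
  \<comment> \<open>A polynomial identity in \<open>t\<close>, \<open>q\<close>, \<open>q'\<close>,
    \<open>q''\<close> as independent variables; the explicit cubic stays folded.\<close>
  have "2 * (1 + t) * (q + t * q') ^ 3 - t * q * (2 * (q + t * q')\<^sup>2 + t * q * (2 * q' + t * q''))
      - 2 * (q + t * q') ^ 3 = t ^ 3 * (4 * q * q'\<^sup>2 + 2 * t * q' ^ 3 - q\<^sup>2 * q'')"
    by (simp add: algebra_simps power2_eq_square power3_eq_cube)
  moreover have "cheb a z - 1 = (2 * (1 + t) * (q + t * q') ^ 3 - t * q * (2 * (q + t * q')\<^sup>2 + t * q * (2 * q' + t * q''))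
      - 2 * (q + t * q') ^ 3) / (2 * (q + t * q') ^ 3)"
    unfolding cheb_def cheb_factor_def p p' p'' using nz by (simp add: diff_divide_distrib z)
  ultimately show ?thesis
    unfolding cheb_cofactor_def q_def[symmetric] q'_def[symmetric] q''_def[symmetric] t_def[symmetric] p' Let_def by simp
qed

lemma isCont_quartic': "isCont (quartic' a) z"
  unfolding quartic'_def by (intro continuous_intros)

lemma open_quartic'_nonzero: "open {z. quartic' a z \<noteq> 0}"
  by (intro open_Collect_neq continuous_at_imp_continuous_on ballI isCont_quartic' continuous_intros)

text \<open>Where \<open>quartic'\<close> vanishes, the numerator of \<open>cheb\<close> reduces to
  minus the product of \<open>(quartic a z)\<^sup>2\<close> and \<open>quartic'' a z\<close>, so
  these two facts make every such point a genuine pole.\<close>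

lemma quartic'_eq_0_imp:
  assumes "0 < a" "a < 1" "quartic' a z = 0"
  shows "quartic a z \<noteq> 0" "quartic'' a z \<noteq> 0"
proof -
  consider "z = 0" | "z\<^sup>2 = of_real ((1 + a) / 2)"
    using assms(3) unfolding quartic'_def mult_eq_0_iff by (auto simp: field_simps)
  then have "quartic a z \<noteq> 0 \<and> quartic'' a z \<noteq> 0"
  proof cases
    case 1
    have "- of_real (2 * (1 + a)) \<noteq> (0 :: 'a)" using assms by (simp only: neg_equal_0_iff_equal of_real_eq_0_iff) simp
    then show ?thesis using 1 assms by (simp add: quartic_def quartic''_def)
  next
    case 2
    have "quartic a z = of_real (((1 + a) / 2 - 1) * ((1 + a) / 2 - a))"
      unfolding quartic_def 2 by (simp only: of_real_mult of_real_diff of_real_1)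
    moreover have "quartic'' a z = of_real (4 * (1 + a))"
      unfolding quartic''_def 2 by simp
    ultimately show ?thesis using assms by (simp only: of_real_eq_0_iff) simp
  qed
  then show "quartic a z \<noteq> 0" "quartic'' a z \<noteq> 0" by auto
qed

section \<open>Infinity and the poles\<close>

text \<open>The map in the coordinate u = 1/z, with its pole at 0 cleared: u C_a(1/u). The local
  \<open>p\<close>, \<open>p'\<close>, \<open>p''\<close> are the reversed polynomials u^4 p(1/u),
  u^3 p'(1/u), u^2 p''(1/u). The value 21/32 at 0 says that C_a(z) behaves like (21/32) z at
  infinity.\<close>

definition cheb_infinity :: "real \<Rightarrow> complex \<Rightarrow> complex" where
  "cheb_infinity a u =
    (let p = (1 - u\<^sup>2) * (1 - of_real a * u\<^sup>2); p' = 4 - of_real (2 * (1 + a)) * u\<^sup>2;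
         p'' = 12 - of_real (2 * (1 + a)) * u\<^sup>2
     in 1 - p * (2 * p'\<^sup>2 + p * p'') / (2 * p' ^ 3))"

lemma cheb_inverse:
  assumes "u \<noteq> 0" "4 - of_real (2 * (1 + a)) * u\<^sup>2 \<noteq> 0"
  shows "quartic' a (inverse u) \<noteq> 0" "cheb a (inverse u) = cheb_infinity a u / u"
proof -
  define p where "p = (1 - u\<^sup>2) * (1 - of_real a * u\<^sup>2)"
  define p' where "p' = 4 - of_real (2 * (1 + a)) * u\<^sup>2"
  define p'' where "p'' = 12 - of_real (2 * (1 + a)) * u\<^sup>2"
  have q: "quartic a (inverse u) = p / u ^ 4"
    using assms(1) by (simp add: p_def quartic_def field_simps eval_nat_numeral)
  have q': "quartic' a (inverse u) = p' / u ^ 3"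
    using assms(1) by (simp add: p'_def quartic'_def field_simps eval_nat_numeral)
  have q'': "quartic'' a (inverse u) = p'' / u\<^sup>2"
    using assms(1) by (simp add: p''_def quartic''_def field_simps eval_nat_numeral)
  have nz: "p' \<noteq> 0" using assms(2) by (simp add: p'_def)
  then show nz': "quartic' a (inverse u) \<noteq> 0" using assms(1) q' by simp
  have "cheb a (inverse u) = (1 - p * (2 * p'\<^sup>2 + p * p'') / (2 * p' ^ 3)) / u"
    unfolding cheb_eq[OF nz'] cheb_factor_def q q' q''
    using assms(1) nz by (simp add: field_simps eval_nat_numeral)
  then show "cheb a (inverse u) = cheb_infinity a u / u"
    unfolding cheb_infinity_def p_def[symmetric] p'_def[symmetric] p''_def[symmetric] Let_def .
qed

lemma cheb_infinity_0: "cheb_infinity a 0 = 21 / 32"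
  by (simp add: cheb_infinity_def)

lemma open_cheb_infinity_denominator: "open {u::complex. 4 - of_real (2 * (1 + a)) * u\<^sup>2 \<noteq> 0}"
  by (intro open_Collect_neq continuous_intros)

lemma cheb_infinity_holomorphic:
  "cheb_infinity a holomorphic_on {u. 4 - of_real (2 * (1 + a)) * u\<^sup>2 \<noteq> 0}"
  unfolding cheb_infinity_def Let_def by (intro holomorphic_intros) auto

lemma isCont_cheb_infinity_0: "isCont (cheb_infinity a) 0"
  using holomorphic_on_imp_continuous_on[OF cheb_infinity_holomorphic[of a]]
    open_cheb_infinity_denominator[of a]
  by (simp add: continuous_on_eq_continuous_at)

lemma eventually_cheb_at_infinity:
  "\<forall>\<^sub>F z in at_infinity. quartic' a z \<noteq> 0 \<and> cheb a z = z * cheb_infinity a (inverse z)"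
proof -
  have "\<forall>\<^sub>F u in nhds 0. u \<in> {u::complex. 4 - of_real (2 * (1 + a)) * u\<^sup>2 \<noteq> 0}"
    using open_cheb_infinity_denominator by (rule eventually_nhds_in_open) simp
  then have "\<forall>\<^sub>F z in at_infinity. inverse z \<in> {u::complex. 4 - of_real (2 * (1 + a)) * u\<^sup>2 \<noteq> 0}"
    using tendsto_inverse_0 unfolding filterlim_iff by blast
  moreover have "\<forall>\<^sub>F z::complex in at_infinity. z \<noteq> 0"
    by (rule eventually_not_equal_at_infinity)
  ultimately show ?thesis
  proof eventually_elim
    case (elim z)
    then show ?case using cheb_inverse[of "inverse z" a] by (simp add: field_simps)
  qed
qed

lemma filterlim_cheb_at_infinity: "filterlim (cheb a :: complex \<Rightarrow> complex) at_infinity at_infinity"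
proof -
  have "((\<lambda>z. cheb_infinity a (inverse z)) \<longlongrightarrow> 21 / 32) at_infinity"
    using isCont_tendsto_compose[OF isCont_cheb_infinity_0[of a] tendsto_inverse_0]
    by (simp add: cheb_infinity_0)
  then have "filterlim (\<lambda>z. cheb_infinity a (inverse z) * z) at_infinity at_infinity"
    by (rule tendsto_mult_filterlim_at_infinity) (auto intro: filterlim_ident)
  moreover have "\<forall>\<^sub>F z in at_infinity. cheb a z = cheb_infinity a (inverse z) * z"
    using eventually_cheb_at_infinity[of a] by eventually_elim simp
  ultimately show ?thesis
    by (simp add: filterlim_cong[OF refl refl])
qed

text \<open>In the coordinate u = 1/z the map is u divided by \<open>cheb_infinity a u\<close>. It
  has derivative 32/21 at 0 and is therefore injective on a small disc, whose radius
  \<open>r\<close> gives the bound \<open>1 / r\<close> on the modulus.\<close>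

lemma cheb_inj_near_infinity:
  obtains R where "\<And>z w. R < cmod z \<Longrightarrow> R < cmod w \<Longrightarrow> cheb a z = cheb a w \<Longrightarrow> z = w"
proof -
  define S0 where "S0 = {u::complex. 4 - of_real (2 * (1 + a)) * u\<^sup>2 \<noteq> 0}"
  define S where "S = S0 \<inter> cheb_infinity a -` (- {0})"
  have "continuous_on S0 (cheb_infinity a)"
    unfolding S0_def by (rule holomorphic_on_imp_continuous_on[OF cheb_infinity_holomorphic])
  then have "open S"
    unfolding S_def by (rule continuous_open_preimage)
      (simp_all only: S0_def open_cheb_infinity_denominator open_Compl closed_singleton)
  have "0 \<in> S" by (simp add: S_def S0_def cheb_infinity_0)
  have hol: "(\<lambda>u. inverse (cheb_infinity a u)) holomorphic_on S"
    by (intro holomorphic_intros holomorphic_on_subset[OF cheb_infinity_holomorphic[of a]])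
      (auto simp: S_def S0_def)
  then have holk: "(\<lambda>u. u * inverse (cheb_infinity a u)) holomorphic_on S"
    by (intro holomorphic_on_mult holomorphic_on_ident)
  from hol obtain d where d: "((\<lambda>u. inverse (cheb_infinity a u)) has_field_derivative d) (at 0)"
    using \<open>0 \<in> S\<close> \<open>open S\<close> by (meson holomorphic_derivI)
  have "((\<lambda>u. u * inverse (cheb_infinity a u)) has_field_derivative 32 / 21) (at 0)"
    by (rule derivative_eq_intros d refl)+ (simp add: cheb_infinity_0)
  then have "deriv (\<lambda>u. u * inverse (cheb_infinity a u)) 0 \<noteq> 0"
    by (simp add: DERIV_imp_deriv)
  from has_complex_derivative_locally_injective[OF holk \<open>0 \<in> S\<close> \<open>open S\<close> this]
  obtain r where r: "r > 0" "ball 0 r \<subseteq> S"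
    and inj: "inj_on (\<lambda>u. u * inverse (cheb_infinity a u)) (ball 0 r)" .
  have *: "inverse z \<in> ball 0 r \<and> inverse z * inverse (cheb_infinity a (inverse z)) = inverse (cheb a z)"
    if "1 / r < cmod z" for z
  proof -
    have "z \<noteq> 0" using that r by auto
    have "inverse z \<in> ball 0 r"
      using that r(1) \<open>z \<noteq> 0\<close> by (simp add: norm_divide field_simps)
    moreover from this r have "inverse z \<in> S" by auto
    then have "cheb a z = cheb_infinity a (inverse z) / inverse z"
      using cheb_inverse(2)[of "inverse z" a] \<open>z \<noteq> 0\<close> by (simp add: S_def S0_def)
    ultimately show ?thesis
      by (simp add: divide_inverse mult.commute del: inverse_eq_divide)
  qed
  show ?thesis
  proof (rule that[of "1 / r"])
    fix z w assume "1 / r < cmod z" "1 / r < cmod w" "cheb a z = cheb a w"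
    then have "inverse z = inverse w" using *[of z] *[of w] inj_onD[OF inj, of "inverse z" "inverse w"] by auto
    then show "z = w" by simp
  qed
qed

lemma finite_quartic'_zeros:
  assumes "a < 1" shows "finite {z::complex. quartic' a z = 0}"
proof -
  \<comment> \<open>Evaluating at 1 shows that the derivative is not the zero polynomial.\<close>
  have "quartic' a (1::complex) \<noteq> 0"
  proof -
    have "quartic' a (1::complex) = of_real (2 * (1 - a))" by (simp add: quartic'_def)
    then show ?thesis using assms by (simp only: of_real_eq_0_iff) simp
  qed
  then have "pderiv (p_poly a) \<noteq> 0" by (metis poly_0 poly_pderiv_p_poly)
  then show ?thesis using poly_roots_finite[of "pderiv (p_poly a)"] by (simp add: poly_pderiv_p_poly)
qed

lemma eventually_quartic'_nonzero:
  assumes "a < 1" shows "\<forall>\<^sub>F w in at z. quartic' a (w::complex) \<noteq> 0"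
proof -
  have "open (- ({w. quartic' a w = 0} - {z}))"
    using finite_quartic'_zeros[OF assms] by (intro open_Compl finite_imp_closed finite_Diff)
  then have "\<forall>\<^sub>F w in at z. w \<in> - ({w. quartic' a w = 0} - {z}) - {z}"
    by (rule eventually_at_in_open) simp
  then show ?thesis by (rule eventually_mono) auto
qed

lemma isCont_cheb:
  fixes z :: "'a::real_normed_field"
  assumes "quartic' a z \<noteq> 0" shows "isCont (cheb a) z"
  using DERIV_cheb[OF assms] by (rule DERIV_isCont)

lemma cheb_pole:
  fixes z :: complex
  assumes "0 < a" "a < 1" "quartic' a z = 0"
  shows "filterlim (cheb a) at_infinity (at z)"
  unfolding cheb_def
proof (rule filterlim_divide_at_infinity)
  have "isCont (\<lambda>z. 2 * z * quartic' a z ^ 3 - quartic a z * cheb_factor a z) z"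
    unfolding cheb_factor_def quartic_def quartic'_def quartic''_def by (intro continuous_intros)
  then show "((\<lambda>z. 2 * z * quartic' a z ^ 3 - quartic a z * cheb_factor a z) \<longlongrightarrow>
     2 * z * quartic' a z ^ 3 - quartic a z * cheb_factor a z) (at z)"
    by (simp only: isCont_def)
  show "2 * z * quartic' a z ^ 3 - quartic a z * cheb_factor a z \<noteq> 0"
    using quartic'_eq_0_imp[OF assms] assms(3) by (simp add: cheb_factor_def)
  have "((\<lambda>z. 2 * quartic' a z ^ 3) \<longlongrightarrow> 2 * quartic' a z ^ 3) (at z)"
    using isCont_quartic'[where a = a and z = z] unfolding isCont_def by (intro tendsto_intros)
  then show "filterlim (\<lambda>z. 2 * quartic' a z ^ 3) (at 0) (at z)"
    using eventually_quartic'_nonzero[OF assms(2), of z] assms(3) by (simp add: filterlim_at)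
qed

section \<open>The method as a self-map of the sphere\<close>

lemma chebyshev_method_Fin:
  assumes "quartic' a z \<noteq> 0"
  shows "chebyshev_method (p_poly a) (Fin z) = Fin (cheb a z)"
  unfolding chebyshev_method_def
proof (rule sphere_extension_Fin)
  have "\<forall>\<^sub>F w in nhds z. w \<in> {w. quartic' a w \<noteq> 0}"
    using open_quartic'_nonzero by (rule eventually_nhds_in_open) (simp add: assms)
  then have "\<forall>\<^sub>F w in at z. w - (1 + L_fun (p_poly a) w / 2) *
      (poly (p_poly a) w / poly (pderiv (p_poly a)) w) = cheb a w"
    unfolding eventually_at_filter by (rule eventually_mono) (intro impI chebyshev_iteration_eq, simp)
  moreover have "(cheb a \<longlongrightarrow> cheb a z) (at z)"
    using isCont_cheb[OF assms] by (simp add: isCont_def)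
  ultimately show "((\<lambda>w. w - (1 + L_fun (p_poly a) w / 2) *
      (poly (p_poly a) w / poly (pderiv (p_poly a)) w)) \<longlongrightarrow> cheb a z) (at z)"
    by (simp add: tendsto_cong)
qed

lemma chebyshev_method_pole:
  assumes "0 < a" "a < 1" "quartic' a z = 0"
  shows "chebyshev_method (p_poly a) (Fin z) = Infty"
  unfolding chebyshev_method_def
proof (rule sphere_extension_pole)
  have "\<forall>\<^sub>F w in at z. w - (1 + L_fun (p_poly a) w / 2) *
      (poly (p_poly a) w / poly (pderiv (p_poly a)) w) = cheb a w"
    using eventually_quartic'_nonzero[OF assms(2)] by eventually_elim (rule chebyshev_iteration_eq)
  then show "filterlim (\<lambda>w. w - (1 + L_fun (p_poly a) w / 2) *
      (poly (p_poly a) w / poly (pderiv (p_poly a)) w)) at_infinity (at z)"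
    using cheb_pole[OF assms] by (simp add: filterlim_cong[OF refl refl])
qed

lemma chebyshev_method_Infty: "chebyshev_method (p_poly a) Infty = Infty"
  unfolding chebyshev_method_def
proof (rule sphere_extension_Infty)
  have "\<forall>\<^sub>F w in at_infinity. w - (1 + L_fun (p_poly a) w / 2) *
      (poly (p_poly a) w / poly (pderiv (p_poly a)) w) = cheb a w"
    using eventually_cheb_at_infinity[of a] by eventually_elim (rule chebyshev_iteration_eq, simp)
  then show "filterlim (\<lambda>w. w - (1 + L_fun (p_poly a) w / 2) *
      (poly (p_poly a) w / poly (pderiv (p_poly a)) w)) at_infinity at_infinity"
    using filterlim_cheb_at_infinity[of a] by (simp add: filterlim_cong[OF refl refl])
qed

lemma isCont_chebyshev_method_Infty: "isCont (chebyshev_method (p_poly a)) Infty"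
proof -
  have "\<forall>\<^sub>F z in at_infinity. chebyshev_method (p_poly a) (Fin z) = Fin (cheb a z)"
    using eventually_cheb_at_infinity[of a] by eventually_elim (simp add: chebyshev_method_Fin)
  then show ?thesis
    using tendsto_Fin_Infty[OF filterlim_cheb_at_infinity[of a]]
    unfolding isCont_def by (simp add: at_Infty filterlim_filtermap chebyshev_method_Infty tendsto_cong)
qed

lemma isCont_chebyshev_method_pole:
  assumes "0 < a" "a < 1" "quartic' a z = 0"
  shows "isCont (chebyshev_method (p_poly a)) (Fin z)"
proof -
  have "\<forall>\<^sub>F w in at z. chebyshev_method (p_poly a) (Fin w) = Fin (cheb a w)"
    using eventually_quartic'_nonzero[OF assms(2)] by eventually_elim (simp add: chebyshev_method_Fin)
  then show ?thesis
    using tendsto_Fin_Infty[OF cheb_pole[OF assms]]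
    unfolding isCont_def by (simp add: at_Fin filterlim_filtermap chebyshev_method_pole[OF assms] tendsto_cong)
qed

lemma funpow_chebyshev_method_Infty: "(chebyshev_method (p_poly a) ^^ n) Infty = Infty"
  by (induction n) (simp_all add: chebyshev_method_Infty)

lemma isCont_funpow_chebyshev_method_Infty: "isCont (chebyshev_method (p_poly a) ^^ n) Infty"
proof (induction n)
  case (Suc n)
  then show ?case
    unfolding funpow.simps
    by (rule continuous_at_compose)
      (simp only: funpow_chebyshev_method_Infty isCont_chebyshev_method_Infty)
qed (simp add: id_def)

text \<open>The first step sends the pole to the fixed point \<open>Infty\<close>, so continuity of
  the map at these two points carries over to all iterates.\<close>

lemma isCont_funpow_chebyshev_method_pole:
  assumes "0 < a" "a < 1" "quartic' a z = 0"
  shows "isCont (chebyshev_method (p_poly a) ^^ n) (Fin z)"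
proof (cases n)
  case (Suc m)
  show ?thesis
    unfolding Suc funpow_Suc_right
    by (rule continuous_at_compose[OF isCont_chebyshev_method_pole[OF assms]])
      (simp only: chebyshev_method_pole[OF assms] isCont_funpow_chebyshev_method_Infty)
qed (simp add: id_def)

lemma funpow_chebyshev_method_pole:
  assumes "0 < a" "a < 1" "quartic' a z = 0" "0 < n"
  shows "(chebyshev_method (p_poly a) ^^ n) (Fin z) = Infty"
proof -
  obtain m where n: "n = Suc m" using \<open>0 < n\<close> gr0_implies_Suc by blast
  show ?thesis
    unfolding n funpow_Suc_right
    by (simp add: chebyshev_method_pole[OF assms(1-3)] funpow_chebyshev_method_Infty)
qed

section \<open>Dynamics on the real line\<close>

text \<open>What the choice of \<open>a1\<close> as the largest positive extraneous fixed point
  yields on the real line: it lies strictly between the largest pole and 1, and the factor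
  responsible for extraneous fixed points is positive beyond it.\<close>

locale chebyshev_real =
  fixes a a1 :: real
  assumes a: "0 < a" "a < 1"
    and a1: "(1 + a) / 2 < a1\<^sup>2" "0 < a1" "a1 < 1"
    and cheb_a1: "cheb a a1 = a1"
    and cheb_factor_pos: "\<And>x. a1 < x \<Longrightarrow> 0 < cheb_factor a x"
begin

lemma quartic'_pos:
  assumes "a1 \<le> x" shows "0 < quartic' a x"
proof -
  have "a1\<^sup>2 \<le> x\<^sup>2" using assms a1 by (intro power_mono) auto
  then have "1 + a < 2 * x\<^sup>2" using a1(1) by (simp add: field_simps)
  then show ?thesis using assms a1(2) by (simp add: quartic'_def)
qed

lemma cheb_deriv:
  assumes "a1 \<le> x"
  shows "\<exists>d. (cheb a has_field_derivative d) (at x) \<and> (x \<noteq> 1 \<longrightarrow> 0 < d)"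
proof -
  have nz: "quartic' a x \<noteq> 0" using quartic'_pos[OF assms] by simp
  have x: "a1\<^sup>2 \<le> x\<^sup>2" "0 < x" using assms a1 by (auto intro: power_mono)
  show ?thesis
  proof (intro exI conjI impI, rule DERIV_cheb[OF nz])
    assume "x \<noteq> 1"
    then have "x\<^sup>2 \<noteq> 1" using \<open>0 < x\<close> by (simp add: power2_eq_1_iff)
    moreover have "x\<^sup>2 \<noteq> a" using x(1) a1 a by auto
    ultimately have "0 < (quartic a x)\<^sup>2" by (simp add: quartic_def)
    moreover have "0 < 12 * x^4 + (4 * x\<^sup>2 - of_real (1 + a))\<^sup>2"
      using x(2) by (intro add_pos_nonneg) auto
    ultimately show "0 < 6 * (quartic a x)\<^sup>2 * (12 * x^4 + (4 * x\<^sup>2 - of_real (1 + a))\<^sup>2) / quartic' a x ^ 4"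
      using nz by (simp only: zero_less_divide_iff zero_less_mult_iff) (simp add: zero_less_power_eq)
  qed
qed

lemma isCont_cheb_real: "a1 \<le> x \<Longrightarrow> isCont (cheb a) x"
  using isCont_cheb quartic'_pos by force

text \<open>The derivative vanishes at 1, so monotonicity is first shown on segments without 1 in
  their interior and then glued there.\<close>

lemma cheb_strict_mono_segment:
  assumes "a1 \<le> x" "x < y" "y \<le> 1 \<or> 1 \<le> x"
  shows "cheb a x < cheb a y"
proof (rule DERIV_pos_imp_increasing_open[OF \<open>x < y\<close>])
  fix t assume t: "x < t" "t < y"
  then have "a1 \<le> t" using assms by simp
  from cheb_deriv[OF this] show "\<exists>d. (cheb a has_field_derivative d) (at t) \<and> 0 < d" using t assms by auto
next
  show "continuous_on {x..y} (cheb a)"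
    using assms by (intro continuous_at_imp_continuous_on ballI isCont_cheb_real) auto
qed

lemma cheb_strict_mono:
  assumes "a1 \<le> x" "x < y" shows "cheb a x < cheb a y"
proof (cases "y \<le> 1 \<or> 1 \<le> x")
  case False
  then have "cheb a x < cheb a 1" "cheb a 1 < cheb a y"
    using assms by (auto intro!: cheb_strict_mono_segment)
  then show ?thesis by simp
qed (use assms cheb_strict_mono_segment in auto)

lemma cheb_mono: "a1 \<le> x \<Longrightarrow> x \<le> y \<Longrightarrow> cheb a x \<le> cheb a y"
  using cheb_strict_mono[of x y] by fastforce

lemma cheb_1: "cheb a (1::real) = 1"
  using cheb_minus_1[of a "1::real"] quartic'_pos[of 1] a1 by simp

lemma cheb_greater: "a1 < x \<Longrightarrow> a1 < cheb a x"
  using cheb_strict_mono[of a1 x] cheb_a1 by simp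

text \<open>In \<open>cheb a x - x\<close> every factor other than \<open>1 - x\<close> is positive
  to the right of \<open>a1\<close>: points move towards 1, and 1 is the only fixed point in this
  range.\<close>

lemma cheb_diff_sgn:
  assumes "a1 < x" shows "sgn (cheb a x - x) = sgn (1 - x)"
proof -
  have q': "0 < quartic' a x" and e: "0 < cheb_factor a x"
    using assms quartic'_pos cheb_factor_pos by auto
  have "a1\<^sup>2 < x\<^sup>2" using assms a1 by (intro power_strict_mono) auto
  then have xa: "0 < x\<^sup>2 - a" using a1 a by (auto simp: field_simps)
  define k where "k = (1 + x) * (x\<^sup>2 - a) * cheb_factor a x / (2 * quartic' a x ^ 3)"
  have "cheb a x - x = (1 - x) * k"
    using q' by (simp add: k_def cheb_eq quartic_def field_simps power2_eq_square)
  moreover have "0 < k"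
    using q' e xa assms a1 by (simp add: k_def)
  ultimately show ?thesis by (simp add: sgn_mult)
qed

lemma cheb_le:
  fixes x :: real
  shows "1 \<le> x \<Longrightarrow> cheb a x \<le> x" and "1 \<le> x \<Longrightarrow> 1 \<le> cheb a x"
  using cheb_diff_sgn[of x] cheb_mono[of 1 x] cheb_1 a1 by (auto simp: sgn_if split: if_splits)

lemma cheb_ge:
  fixes x :: real
  shows "a1 < x \<Longrightarrow> x \<le> 1 \<Longrightarrow> x \<le> cheb a x" and "a1 < x \<Longrightarrow> x \<le> 1 \<Longrightarrow> cheb a x \<le> 1"
  using cheb_diff_sgn[of x] cheb_mono[of x 1] cheb_1 by (auto simp: sgn_if split: if_splits)

text \<open>Orbits are monotone and stay on their side of 1, so they converge; by continuity the
  limit is a fixed point greater than \<open>a1\<close>, which can only be 1.\<close>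

lemma funpow_cheb_tendsto:
  assumes "a1 < x" shows "(\<lambda>n. (cheb a ^^ n) x) \<longlonglongrightarrow> 1"
proof -
  define X where "X n = (cheb a ^^ n) x" for n
  have Suc: "X (Suc n) = cheb a (X n)" for n by (simp add: X_def)
  have "\<exists>L. X \<longlonglongrightarrow> L \<and> a1 < L"
  proof (cases "x \<le> 1")
    case True
    have *: "x \<le> X n \<and> X n \<le> 1" for n
      using cheb_ge[of "X n"] assms True
    proof (induction n)
      case 0 then show ?case by (simp add: X_def)
    next
      case (Suc n)
      then have "x \<le> X n" "X n \<le> 1" using cheb_ge[of "X n"] by auto
      then show ?case using cheb_ge[of "X n"] assms by (simp add: \<open>X (Suc n) = cheb a (X n)\<close>)
    qed
    have "incseq X" using * cheb_ge assms by (intro incseq_SucI) (simp add: Suc less_le_trans)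
    then obtain L where L: "X \<longlonglongrightarrow> L" "\<And>n. X n \<le> L"
      using incseq_convergent[of X 1] * by blast
    \<comment> \<open>The first term of the orbit is \<open>x\<close>, so the limit is at least
      \<open>x\<close> and cannot drop to the fixed point \<open>a1\<close>.\<close>
    then show ?thesis using L(2)[of 0] assms by (auto simp: X_def)
  next
    case False
    have *: "1 \<le> X n" for n
      by (induction n) (use False cheb_le in \<open>auto simp: X_def\<close>)
    then have "decseq X" using cheb_le by (intro decseq_SucI) (simp add: Suc)
    then obtain L where L: "X \<longlonglongrightarrow> L"
      using decseq_convergent[of X 1] * by blast
    then have "1 \<le> L" using * by (intro LIMSEQ_le_const) auto
    then show ?thesis using L a1 by auto
  qed
  then obtain L where L: "X \<longlonglongrightarrow> L" "a1 < L" by blast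
  have "(\<lambda>n. cheb a (X n)) \<longlonglongrightarrow> cheb a L"
    using L isCont_cheb_real[of L] by (intro isCont_tendsto_compose[of L "cheb a"]) auto
  moreover have "(\<lambda>n. cheb a (X n)) \<longlonglongrightarrow> L"
    using LIMSEQ_Suc[OF L(1)] by (simp add: Suc)
  ultimately have "cheb a L = L" by (rule LIMSEQ_unique)
  then have "L = 1" using cheb_diff_sgn[OF L(2)] by (simp add: sgn_if split: if_splits)
  then show ?thesis using L by (simp add: X_def[abs_def])
qed

end

text \<open>Real zeros of \<open>cheb_factor\<close> off the zeros of \<open>quartic\<close> and
  \<open>quartic'\<close> are extraneous fixed points. The factor is negative at the largest pole
  \<open>x0\<close> and positive from 1 on, so the intermediate value theorem puts a zero between
  them. Maximality of \<open>a1\<close> then places it beyond \<open>x0\<close> and excludes sign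
  changes to its right.\<close>

lemma chebyshev_realI:
  assumes a: "0 < a" "a < 1" and "0 < a1"
    and ext: "complex_of_real a1 \<in> extraneous_fixed_points (p_poly a)"
    and max: "\<And>x::real. 0 < x \<Longrightarrow> complex_of_real x \<in> extraneous_fixed_points (p_poly a) \<Longrightarrow> x \<le> a1"
  shows "chebyshev_real a a1"
proof -
  have a1': "quartic' a (complex_of_real a1) \<noteq> 0"
    using ext chebyshev_method_pole[OF a, of a1] by (auto simp: extraneous_fixed_points_def)
  then have "cheb a (complex_of_real a1) = a1"
    using ext by (simp add: extraneous_fixed_points_def chebyshev_method_Fin)
  then have fixed: "cheb a a1 = a1" by (simp flip: of_real_cheb)
  have "quartic' a a1 \<noteq> 0" "quartic a a1 \<noteq> 0"
    using a1' ext by (simp_all add: extraneous_fixed_points_def poly_p_poly flip: of_real_quartic of_real_quartic')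
  then have factor_a1: "cheb_factor a a1 = 0"
    using fixed by (simp add: cheb_eq)
  have le_a1: "x \<le> a1" if "0 < x" "quartic' a x \<noteq> 0" "quartic a x \<noteq> 0" "cheb_factor a x = 0" for x
  proof (rule max[OF \<open>0 < x\<close>])
    have "quartic' a (complex_of_real x) \<noteq> 0" using that(2) by (simp flip: of_real_quartic')
    moreover have "cheb a (complex_of_real x) = x"
      using that by (simp add: cheb_eq flip: of_real_cheb)
    moreover have "quartic a (complex_of_real x) \<noteq> 0" using that(3) by (simp flip: of_real_quartic)
    ultimately show "complex_of_real x \<in> extraneous_fixed_points (p_poly a)"
      by (simp add: extraneous_fixed_points_def poly_p_poly chebyshev_method_Fin)
  qed
  define x0 where "x0 = sqrt ((1 + a) / 2)"
  have x0: "x0\<^sup>2 = (1 + a) / 2" "0 < x0" "x0 < 1" using a by (auto simp: x0_def)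
  have factor_pos: "0 < cheb_factor a x" if x: "1 \<le> x" for x :: real
  proof -
    obtain y where y: "x\<^sup>2 = y" "1 \<le> y" using one_le_power[OF x, of 2] by blast
    have "0 \<le> quartic a x"
      using a y(2) unfolding quartic_def y(1) by (intro mult_nonneg_nonneg) auto
    moreover have "0 < quartic'' a x" using a y(2) by (simp add: quartic''_def y(1))
    moreover have "quartic' a x \<noteq> 0" using a y(2) that by (simp add: quartic'_def y(1))
    ultimately show ?thesis unfolding cheb_factor_def by (intro add_pos_nonneg) auto
  qed
  \<comment> \<open>At \<open>x0\<close> the derivative vanishes, so only the product of
    \<open>quartic\<close> (negative) and \<open>quartic''\<close> (positive) remains.\<close>
  have factor_x0: "cheb_factor a x0 < 0"
  proof -
    have "cheb_factor a x0 = ((1 + a) / 2 - 1) * ((1 + a) / 2 - a) * (4 * (1 + a))"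
      unfolding cheb_factor_def quartic'_def quartic_def quartic''_def x0 by (simp add: field_simps)
    also have "\<dots> < 0" using a by (intro mult_neg_pos) auto
    finally show ?thesis .
  qed
  \<comment> \<open>Used twice: with \<open>x = x0\<close> to get \<open>x0 < a1\<close>, and with
    an \<open>x\<close> beyond \<open>a1\<close> where positivity fails, to reach a
    contradiction.\<close>
  have root: "\<exists>y. x \<le> y \<and> y < 1 \<and> y \<le> a1 \<and> x0 < y"
    if x: "x0 \<le> x" "x \<le> 1" "cheb_factor a x \<le> 0" for x
  proof -
    have "continuous_on {x..1} (cheb_factor a)"
      unfolding cheb_factor_def quartic'_def quartic_def quartic''_def by (intro continuous_intros)
    then obtain y where y: "x \<le> y" "y \<le> 1" "cheb_factor a y = 0"
      using IVT'[of "cheb_factor a" x 0 1] x factor_pos[of 1] by auto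
    then have "y \<noteq> 1" "y \<noteq> x0" using factor_pos[of 1] factor_x0 by auto
    then have "y < 1" "x0 < y" using y x by auto
    then have "x0\<^sup>2 < y\<^sup>2" "y\<^sup>2 < 1" using x0 by (auto intro: power_strict_mono simp: power_less_one_iff)
    then have "quartic' a y \<noteq> 0" "quartic a y \<noteq> 0"
      using x0 a \<open>x0 < y\<close> by (auto simp: quartic'_def quartic_def)
    then have "y \<le> a1" using le_a1[of y] y x0 \<open>x0 < y\<close> by auto
    then show ?thesis using y \<open>y < 1\<close> \<open>x0 < y\<close> by blast
  qed
  from root[of x0] x0 factor_x0 have "x0 < a1" by auto
  show ?thesis
  proof
    show "0 < a" "a < 1" "0 < a1" "cheb a a1 = a1" by fact+
    show "(1 + a) / 2 < a1\<^sup>2"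
      unfolding x0(1)[symmetric] using \<open>x0 < a1\<close> x0 by (intro power_strict_mono) auto
    show "a1 < 1" using factor_pos[of a1] factor_a1 by force
    show "0 < cheb_factor a x" if "a1 < x" for x
    proof (rule ccontr)
      assume "\<not> 0 < cheb_factor a x"
      moreover from this have "x < 1" using factor_pos[of x] by force
      ultimately show False using root[of x] that \<open>x0 < a1\<close> by auto
    qed
  qed
qed

section \<open>The basin of 1\<close>

text \<open>A sequence in the family is an arbitrary choice of exponents. Either some exponent
  recurs infinitely often, giving a constant subsequence, or the exponents tend to infinity and the
  whole sequence converges uniformly to \<open>q\<close>.\<close>

lemma normal_family_iterates_if_uniform_limit_const:
  fixes f :: "'a::metric_space \<Rightarrow> 'a"
  assumes "\<And>e. 0 < e \<Longrightarrow> \<exists>N. \<forall>n\<ge>N. \<forall>x\<in>U. dist ((f ^^ n) x) q < e"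
  shows "normal_family (range (\<lambda>n. f ^^ n)) U"
  unfolding normal_family_def
proof (intro allI impI)
  fix F :: "nat \<Rightarrow> 'a \<Rightarrow> 'a" assume "range F \<subseteq> range (\<lambda>n. f ^^ n)"
  then have "\<forall>i. \<exists>k. F i = f ^^ k" by blast
  then obtain k where k: "\<And>i. F i = f ^^ k i" by metis
  show "\<exists>r g. strict_mono r \<and> (\<forall>K. compact K \<and> K \<subseteq> U \<longrightarrow> uniform_limit K (\<lambda>n. F (r n)) g sequentially)"
  proof (cases "\<exists>m. infinite {i. k i = m}")
    case True
    then obtain m where m: "infinite {i. k i = m}" by blast
    have "F (enumerate {i. k i = m} n) = f ^^ m" for n
      using enumerate_in_set[OF m] k by simp
    then have "uniform_limit K (\<lambda>n. F (enumerate {i. k i = m} n)) (f ^^ m) sequentially" for K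
      by (simp add: uniform_limit_const)
    then show ?thesis using strict_mono_enumerate[OF m] by blast
  next
    case False
    have "uniform_limit K (\<lambda>n. F (id n)) (\<lambda>_. q) sequentially" if "K \<subseteq> U" for K
    proof (rule uniform_limitI)
      fix e :: real assume "0 < e"
      then obtain N where N: "\<And>n x. N \<le> n \<Longrightarrow> x \<in> U \<Longrightarrow> dist ((f ^^ n) x) q < e"
        using assms by blast
      have "finite (\<Union>m<N. {i. k i = m})" using False by blast
      then have "finite {i. k i < N}" by (rule rev_finite_subset) blast
      then have "\<forall>\<^sub>F i in sequentially. N \<le> k i"
        by (simp add: eventually_cofinite not_le flip: cofinite_eq_sequentially)
      then show "\<forall>\<^sub>F n in sequentially. \<forall>x\<in>K. dist (F (id n) x) q < e"
        by (rule eventually_mono) (use N that k in auto)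
    qed
    then show ?thesis using strict_mono_id by blast
  qed
qed

text \<open>Zeros of \<open>quartic'\<close> are excluded at every step, since \<open>cheb\<close>
  has the value 0 there instead of infinity. On these sets iterating \<open>cheb\<close> agrees with
  iterating the sphere map.\<close>

primrec cheb_preimage :: "real \<Rightarrow> complex set \<Rightarrow> nat \<Rightarrow> complex set" where
  "cheb_preimage a B 0 = B"
| "cheb_preimage a B (Suc n) = {z. quartic' a z \<noteq> 0 \<and> cheb a z \<in> cheb_preimage a B n}"

lemma open_cheb_preimage: "open B \<Longrightarrow> open (cheb_preimage a B n)"
proof (induction n)
  case (Suc n)
  have "continuous_on {z. quartic' a z \<noteq> 0} (cheb a :: complex \<Rightarrow> complex)"
    by (auto intro!: continuous_at_imp_continuous_on isCont_cheb)
  then have "open ({z. quartic' a z \<noteq> 0} \<inter> cheb a -` cheb_preimage a B n)"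
    using open_quartic'_nonzero Suc by (auto intro: continuous_open_preimage)
  then show ?case by (simp add: Int_def vimage_def)
qed simp

text \<open>A disc around 1 on which the map halves distances to 1. The bound
  \<open>r \<le> 1 - a1\<close> puts its real points inside the range where \<open>cheb a\<close> is
  strictly increasing.\<close>

locale chebyshev_basin = chebyshev_real +
  fixes r :: real
  assumes r: "0 < r" "r \<le> 1 - a1"
    and r_quartic': "\<And>z. z \<in> ball (1::complex) r \<Longrightarrow> quartic' a z \<noteq> 0"
    and contract: "\<And>z. z \<in> ball (1::complex) r \<Longrightarrow> dist 1 (cheb a z) \<le> dist 1 z / 2"
begin

abbreviation C :: "riemann_sphere \<Rightarrow> riemann_sphere" where
  "C \<equiv> chebyshev_method (p_poly a)"

definition basin :: "complex set" where
  "basin = (\<Union>n. cheb_preimage a (ball 1 r) n)"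

text \<open>A component of a plane set, which gives access to holomorphic function theory; it enters
  the sphere through its inclusion in the immediate basin.\<close>

definition basin_component :: "complex set" where
  "basin_component = connected_component_set basin 1"

lemma open_basin: "open basin"
  unfolding basin_def by (intro open_UN ballI open_cheb_preimage open_ball)

lemma ball_subset_basin: "ball 1 r \<subseteq> basin"
  unfolding basin_def by (metis UN_upper UNIV_I cheb_preimage.simps(1))

lemma one_in_basin: "1 \<in> basin"
  using ball_subset_basin r by auto

lemma basin_quartic': "z \<in> basin \<Longrightarrow> quartic' a z \<noteq> 0"
  unfolding basin_def
proof (elim UN_E)
  fix n assume "z \<in> cheb_preimage a (ball 1 r) n"
  then show "quartic' a z \<noteq> 0" by (cases n) (auto simp: r_quartic')
qed

lemma basin_preimage: "quartic' a z \<noteq> 0 \<Longrightarrow> cheb a z \<in> basin \<Longrightarrow> z \<in> basin"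
  unfolding basin_def
proof (elim UN_E)
  fix n assume "quartic' a z \<noteq> 0" "cheb a z \<in> cheb_preimage a (ball 1 r) n"
  then have "z \<in> cheb_preimage a (ball 1 r) (Suc n)" by simp
  then show "z \<in> (\<Union>n. cheb_preimage a (ball 1 r) n)" by blast
qed

lemma funpow_C_ball:
  assumes "z \<in> ball 1 r"
  shows "\<exists>v \<in> ball 1 r. (C ^^ n) (Fin z) = Fin v \<and> dist 1 v \<le> r / 2 ^ n"
proof (induction n)
  case 0
  then show ?case using assms by auto
next
  case (Suc n)
  then obtain v where v: "v \<in> ball 1 r" "(C ^^ n) (Fin z) = Fin v" "dist 1 v \<le> r / 2 ^ n" by blast
  have "dist 1 (cheb a v) \<le> dist 1 v / 2" by (rule contract[OF v(1)])
  moreover have "dist 1 v < r" using v(1) by simp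
  moreover have "dist 1 v / 2 \<le> r / 2 ^ Suc n"
    using divide_right_mono[OF v(3), of 2] by (simp add: mult.commute)
  ultimately have "cheb a v \<in> ball 1 r" "dist 1 (cheb a v) \<le> r / 2 ^ Suc n"
    using zero_le_dist[of 1 v] unfolding mem_ball by linarith+
  then show ?case using v r_quartic'[OF v(1)] by (simp add: chebyshev_method_Fin)
qed

lemma funpow_C_preimage:
  "z \<in> cheb_preimage a (ball 1 r) n \<Longrightarrow> \<exists>v \<in> ball 1 r. (C ^^ n) (Fin z) = Fin v"
  by (induction n arbitrary: z) (auto simp: funpow_Suc_right chebyshev_method_Fin simp del: funpow.simps(2))

lemma funpow_C_uniform:
  assumes "0 < e"
  shows "\<exists>N. \<forall>n\<ge>N. \<forall>x \<in> Fin ` cheb_preimage a (ball 1 r) k. dist ((C ^^ n) x) (Fin 1) < e"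
proof -
  obtain d where d: "0 < d" "\<And>v. dist 1 v < d \<Longrightarrow> dist (Fin v) (Fin 1) < e"
    using isCont_Fin[of 1] assms unfolding continuous_at_eps_delta by (metis dist_commute)
  have "(\<lambda>n. r / 2 ^ n) \<longlonglongrightarrow> 0" by real_asymp
  then obtain M where M: "\<And>n. M \<le> n \<Longrightarrow> r / 2 ^ n < d"
    using order_tendstoD(2)[of _ 0 sequentially d] d(1) unfolding eventually_sequentially by blast
  show ?thesis
  proof (intro exI allI impI ballI)
    \<comment> \<open>After \<open>k\<close> steps the orbit is in the disc; at least
      \<open>M\<close> further halvings bring it within \<open>d\<close> of 1.\<close>
    fix n x assume n: "M + k \<le> n" and "x \<in> Fin ` cheb_preimage a (ball 1 r) k"
    then obtain z where x: "x = Fin z" "z \<in> cheb_preimage a (ball 1 r) k" by blast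
    obtain u where u: "u \<in> ball 1 r" "(C ^^ k) x = Fin u"
      using funpow_C_preimage[OF x(2)] x(1) by blast
    obtain v where v: "(C ^^ (n - k)) (Fin u) = Fin v" "dist 1 v \<le> r / 2 ^ (n - k)"
      using funpow_C_ball[OF u(1)] by blast
    have "(C ^^ n) x = (C ^^ (n - k)) ((C ^^ k) x)"
      using n by (simp flip: funpow_add[THEN fun_cong, unfolded comp_def])
    then have "(C ^^ n) x = Fin v" using u v by simp
    moreover have "dist 1 v < d" using v(2) M[of "n - k"] n by linarith
    ultimately show "dist ((C ^^ n) x) (Fin 1) < e" using d(2) by simp
  qed
qed

lemma funpow_C_tendsto: "z \<in> basin \<Longrightarrow> (\<lambda>n. (C ^^ n) (Fin z)) \<longlonglongrightarrow> Fin 1"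
  unfolding basin_def
proof (elim UN_E, rule metric_LIMSEQ_I)
  fix k e assume "z \<in> cheb_preimage a (ball 1 r) k" "(0::real) < e"
  then show "\<exists>N. \<forall>n\<ge>N. dist ((C ^^ n) (Fin z)) (Fin 1) < e"
    using funpow_C_uniform[of e k] by blast
qed

lemma basin_subset_fatou_set: "Fin ` basin \<subseteq> fatou_set C"
proof
  fix x assume "x \<in> Fin ` basin"
  then obtain k where "x \<in> Fin ` cheb_preimage a (ball 1 r) k" by (auto simp: basin_def)
  moreover have "normal_family (range (\<lambda>n. C ^^ n)) (Fin ` cheb_preimage a (ball 1 r) k)"
    by (rule normal_family_iterates_if_uniform_limit_const) (rule funpow_C_uniform)
  ultimately show "x \<in> fatou_set C"
    unfolding fatou_set_def
    by (intro CollectI exI[of _ "Fin ` cheb_preimage a (ball 1 r) k"] conjI open_Fin_image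
        open_cheb_preimage open_ball)
qed

lemma basin_component_subset_basin: "basin_component \<subseteq> basin"
  unfolding basin_component_def by (rule connected_component_subset)

lemma open_basin_component: "open basin_component"
  unfolding basin_component_def by (rule open_connected_component[OF open_basin])

lemma subset_basin_component: "connected S \<Longrightarrow> 1 \<in> S \<Longrightarrow> S \<subseteq> basin \<Longrightarrow> S \<subseteq> basin_component"
  unfolding basin_component_def by (rule connected_component_maximal)

lemma ball_subset_basin_component: "ball 1 r \<subseteq> basin_component"
  using r by (intro subset_basin_component ball_subset_basin) auto

text \<open>Components are relatively closed; this keeps limits of preimages in the component once
  they are known to lie in the basin.\<close>

lemma basin_component_closed_in_basin:
  assumes "z \<in> closure basin_component" "z \<in> basin" shows "z \<in> basin_component"
proof -
  have "closedin (top_of_set basin) basin_component"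
    unfolding basin_component_def by (rule closedin_connected_component)
  then obtain T where "closed T" "basin_component = basin \<inter> T" by (auto simp: closedin_closed)
  moreover from this have "closure basin_component \<subseteq> T" by (intro closure_minimal) auto
  ultimately show ?thesis using assms by blast
qed

lemma basin_component_subset_immediate_basin: "Fin ` basin_component \<subseteq> immediate_basin C (Fin 1)"
  unfolding immediate_basin_def
proof (rule connected_component_maximal)
  show "Fin 1 \<in> Fin ` basin_component" using ball_subset_basin_component r(1) by (intro imageI subsetD[OF ball_subset_basin_component]) simp
  show "connected (Fin ` basin_component)" unfolding basin_component_def by (intro connected_Fin_image connected_connected_component)
  show "Fin ` basin_component \<subseteq> fatou_set C" using basin_component_subset_basin basin_subset_fatou_set by blast
qed

lemma cheb_preimage_real:
  "a1 < x \<Longrightarrow> (cheb a ^^ n) x \<in> ball 1 r \<Longrightarrow> of_real x \<in> cheb_preimage a (ball 1 r) n"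
proof (induction n arbitrary: x)
  case 0
  then have "dist (of_real 1) (complex_of_real x) < r" by (simp only: dist_of_real) simp
  then show ?case by simp
next
  case (Suc n)
  then have "of_real (cheb a x) \<in> cheb_preimage a (ball 1 r) n"
    by (intro Suc.IH cheb_greater) (simp_all add: funpow_Suc_right del: funpow.simps)
  moreover have "quartic' a (complex_of_real x) \<noteq> 0"
    using quartic'_pos[of x] Suc.prems by (simp flip: of_real_quartic')
  ultimately show ?case by (simp add: of_real_cheb)
qed

lemma real_in_basin: "a1 < x \<Longrightarrow> of_real x \<in> basin"
proof -
  assume x: "a1 < x"
  obtain n where "dist ((cheb a ^^ n) x) 1 < r"
    using metric_LIMSEQ_D[OF funpow_cheb_tendsto[OF x] r(1)] by blast
  then show ?thesis
    unfolding basin_def using cheb_preimage_real[OF x, of n] by (auto simp: dist_commute)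
qed

lemma ray_subset_basin_component: "complex_of_real ` {a1<..} \<subseteq> basin_component"
proof (rule subset_basin_component)
  show "connected (complex_of_real ` {a1<..})"
    by (intro connected_continuous_image continuous_intros connected_Ioi)
  show "1 \<in> complex_of_real ` {a1<..}" using a1 by (auto intro: image_eqI[of _ _ 1])
qed (use real_in_basin in auto)

end

section \<open>basin_component pole on the boundary\<close>

context chebyshev_basin
begin

text \<open>Normality would give a uniform limit of iterates on the compact set formed by the pole
  and a sequence of basin points tending to it. The limit is \<open>Infty\<close> at the pole and
  \<open>Fin 1\<close> on the sequence, which contradicts the continuity of a single late iterate at
  the pole.\<close>

lemma pole_not_in_fatou_set:
  assumes "quartic' a z = 0" "z \<in> closure basin_component"
  shows "Fin z \<notin> fatou_set C"
proof
  assume "Fin z \<in> fatou_set C"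
  then obtain U where U: "open U" "Fin z \<in> U" "normal_family (range (\<lambda>n. C ^^ n)) U"
    by (auto simp: fatou_set_def)
  obtain s g where s: "strict_mono (s :: nat \<Rightarrow> nat)"
    and g: "\<And>K. compact K \<Longrightarrow> K \<subseteq> U \<Longrightarrow> uniform_limit K (\<lambda>n. C ^^ s n) g sequentially"
    using U(3)[unfolded normal_family_def, rule_format, of "\<lambda>n. C ^^ n"] by auto
  obtain x where x: "\<And>n. x n \<in> basin_component" "x \<longlonglongrightarrow> z"
    using assms(2) by (auto simp: closure_sequential)
  then have lim: "(\<lambda>n. Fin (x n)) \<longlonglongrightarrow> Fin z" by (simp add: tendsto_Fin_iff)
  obtain N where N: "\<And>n. N \<le> n \<Longrightarrow> Fin (x n) \<in> U"
    using topological_tendstoD[OF lim U(1,2)] by (auto simp: eventually_sequentially)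
  define y where "y n = Fin (x (n + N))" for n
  have y: "y \<longlonglongrightarrow> Fin z" unfolding y_def by (rule LIMSEQ_ignore_initial_segment[OF lim])
  define K where "K = insert (Fin z) (range y)"
  have "compact (Fin ` insert z (range (\<lambda>n. x (n + N))))"
    by (intro compact_continuous_image compact_sequence_with_limit LIMSEQ_ignore_initial_segment x
        continuous_at_imp_continuous_on ballI isCont_Fin)
  moreover have "Fin ` insert z (range (\<lambda>n. x (n + N))) = K"
    by (auto simp: K_def y_def)
  ultimately have "compact K" by simp
  moreover have "K \<subseteq> U" using N U(2) by (auto simp: K_def y_def)
  ultimately have unif: "uniform_limit K (\<lambda>n. C ^^ s n) g sequentially" by (rule g)
  have gz: "g (Fin z) = Infty"
  proof (rule LIMSEQ_unique)
    show "(\<lambda>n. (C ^^ s n) (Fin z)) \<longlonglongrightarrow> g (Fin z)"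
      using unif by (rule tendsto_uniform_limitI) (simp add: K_def)
    have "\<forall>\<^sub>F n in sequentially. (C ^^ s n) (Fin z) = Infty"
      using eventually_gt_at_top[of 0]
    proof eventually_elim
      case (elim n)
      then have "0 < s n" using seq_suble[OF s, of n] by simp
      then show ?case using a assms(1) by (intro funpow_chebyshev_method_pole)
    qed
    then show "(\<lambda>n. (C ^^ s n) (Fin z)) \<longlonglongrightarrow> Infty" by (rule tendsto_eventually)
  qed
  have gy: "g (y j) = Fin 1" for j
  proof (rule LIMSEQ_unique)
    show "(\<lambda>n. (C ^^ s n) (y j)) \<longlonglongrightarrow> g (y j)"
      using unif by (rule tendsto_uniform_limitI) (simp add: K_def)
    have "(\<lambda>n. (C ^^ n) (y j)) \<longlonglongrightarrow> Fin 1"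
      unfolding y_def using x(1) basin_component_subset_basin by (intro funpow_C_tendsto) auto
    from LIMSEQ_subseq_LIMSEQ[OF this s]
    show "(\<lambda>n. (C ^^ s n) (y j)) \<longlonglongrightarrow> Fin 1" by (simp add: comp_def)
  qed
  define e where "e = dist (Fin 1) Infty"
  have "0 < e / 2" by (simp add: e_def)
  have "\<forall>\<^sub>F n in sequentially. \<forall>w\<in>K. dist ((C ^^ s n) w) (g w) < e / 2"
    using uniform_limitD[OF unif \<open>0 < e / 2\<close>] .
  then obtain m where m: "\<And>n w. m \<le> n \<Longrightarrow> w \<in> K \<Longrightarrow> dist ((C ^^ s n) w) (g w) < e / 2"
    unfolding eventually_sequentially by blast
  \<comment> \<open>The index \<open>Suc m\<close> guarantees a positive exponent; the zeroth
    iterate would leave the pole in place.\<close>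
  have pos: "0 < s (Suc m)" using seq_suble[OF s, of "Suc m"] by simp
  have "(\<lambda>j. (C ^^ s (Suc m)) (y j)) \<longlonglongrightarrow> (C ^^ s (Suc m)) (Fin z)"
    by (rule isCont_tendsto_compose[OF isCont_funpow_chebyshev_method_pole[OF a assms(1)] y])
  then have "(\<lambda>j. (C ^^ s (Suc m)) (y j)) \<longlonglongrightarrow> Infty"
    by (simp only: funpow_chebyshev_method_pole[OF a assms(1) pos])
  from tendstoD[OF this \<open>0 < e / 2\<close>]
  obtain j where j: "dist ((C ^^ s (Suc m)) (y j)) Infty < e / 2"
    by (auto simp: eventually_sequentially)
  have "dist ((C ^^ s (Suc m)) (y j)) (Fin 1) < e / 2"
    using m[of "Suc m" "y j"] by (simp add: K_def gy)
  with j have "dist (Fin 1) Infty < e"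
    using dist_triangle2[of "Fin 1" Infty "(C ^^ s (Suc m)) (y j)"]
    by (metis dist_commute dist_triangle_half_r)
  then show False by (simp add: e_def)
qed

section \<open>Non-real preimages of real values\<close>

lemma holomorphic_cheb: "cheb a holomorphic_on {z. quartic' a z \<noteq> 0}"
  unfolding holomorphic_on_def field_differentiable_def
  using has_field_derivative_at_within[OF DERIV_cheb] by blast

text \<open>The cofactor is positive at 1, so \<open>cheb a z - 1\<close> is the cube of a function
  \<open>h\<close> that is locally invertible at 1. The value 1 + t^3 is then attained where
  \<open>h\<close> is t and where it is t times a nontrivial cube root of unity; strict monotonicity
  on the reals prevents both points from being real.\<close>

lemma nonreal_preimage_near_1:
  obtains z t where "z \<in> ball 1 r" "z \<notin> \<real>" "1 < t" "cheb a z = complex_of_real t"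
proof -
  let ?G = "cheb_cofactor a :: complex \<Rightarrow> complex"
  have "quartic' a (1::real) = 2 * (1 - a)" by (simp add: quartic'_def)
  \<comment> \<open>The numerator of the cofactor at 1, where the cubic \<open>q\<close> and its
    first two derivatives have the values 2(1-a), 5-a and 8.\<close>
  moreover have "(4 * (2 * (1 - a)) * (5 - a)\<^sup>2 + 2 * (1 - 1) * (5 - a) ^ 3 - (2 * (1 - a))\<^sup>2 * 8)
      = 8 * (1 - a) * (a\<^sup>2 + 21 - 6 * a)"
    by (simp add: algebra_simps power2_eq_square)
  moreover have "0 < 8 * (1 - a) * (a\<^sup>2 + 21 - 6 * a)"
    by (intro mult_pos_pos; use a zero_le_power2[of a] in linarith)
  ultimately have "0 < cheb_cofactor a (1::real)"
    using a by (simp add: cheb_cofactor_def Let_def)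
  moreover have "?G 1 = of_real (cheb_cofactor a 1)"
    by (simp add: cheb_cofactor_def Let_def of_real_quartic')
  ultimately have G1: "?G 1 \<notin> \<real>\<^sub>\<le>\<^sub>0" by simp
  have holG: "?G holomorphic_on ball 1 r"
    unfolding cheb_cofactor_def Let_def quartic'_def
    by (intro holomorphic_intros) (use r_quartic' in \<open>auto simp: quartic'_def\<close>)
  \<comment> \<open>Staying off the branch cut of \<open>Ln\<close> makes the principal cube root of
    the cofactor holomorphic.\<close>
  define S where "S = ball 1 r \<inter> ?G -` (- \<real>\<^sub>\<le>\<^sub>0)"
  have "open S"
    unfolding S_def
    by (intro continuous_open_preimage holomorphic_on_imp_continuous_on holG) auto
  have "1 \<in> S" using G1 r by (simp add: S_def)
  define h where "h z = (z - 1) * exp (Ln (?G z) / 3)" for z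
  have "(\<lambda>z. exp (Ln (?G z) / 3)) holomorphic_on S"
    by (intro holomorphic_intros holomorphic_on_subset[OF holG]) (auto simp: S_def)
  then have holh: "h holomorphic_on S"
    unfolding h_def
    by (intro holomorphic_on_mult holomorphic_on_diff holomorphic_on_ident holomorphic_on_const)
  obtain d where "((\<lambda>z. exp (Ln (?G z) / 3)) has_field_derivative d) (at 1)"
    using \<open>(\<lambda>z. exp (Ln (?G z) / 3)) holomorphic_on S\<close> \<open>1 \<in> S\<close> \<open>open S\<close> by (meson holomorphic_derivI)
  then have "(h has_field_derivative 1 * exp (Ln (?G 1) / 3) + d * (1 - 1)) (at 1)"
    unfolding h_def by (intro DERIV_mult) (auto intro!: derivative_eq_intros)
  then have "deriv h 1 \<noteq> 0" by (simp add: DERIV_imp_deriv)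
  from has_complex_derivative_locally_invertible[OF holh \<open>1 \<in> S\<close> \<open>open S\<close> this]
  obtain \<rho> where \<rho>: "0 < \<rho>" "ball 1 \<rho> \<subseteq> S" "open (h ` ball 1 \<rho>)" .
  have "h 1 \<in> h ` ball 1 \<rho>" using \<rho>(1) by simp
  then have "0 \<in> h ` ball 1 \<rho>" by (simp add: h_def)
  then obtain \<epsilon> where \<epsilon>: "0 < \<epsilon>" "ball 0 \<epsilon> \<subseteq> h ` ball 1 \<rho>"
    using \<rho>(3) open_contains_ball by blast
  define t where "t = \<epsilon> / 2"
  define \<omega> where "\<omega> = cis (2 * pi / 3)"
  have \<omega>: "\<omega> ^ 3 = 1" "cmod \<omega> = 1" "\<omega> \<noteq> 1"
  proof -
    show "\<omega> ^ 3 = 1" by (simp add: \<omega>_def Complex.DeMoivre)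
    show "cmod \<omega> = 1" by (simp add: \<omega>_def)
    have "Im \<omega> > 0" unfolding \<omega>_def by (simp, intro sin_gt_zero) (auto simp: pi_gt_zero)
    then show "\<omega> \<noteq> 1" by auto
  qed
  have t: "0 < t" "t < \<epsilon>" using \<epsilon> by (auto simp: t_def)
  have "complex_of_real t \<in> ball 0 \<epsilon>" using t by simp
  with \<epsilon>(2) have "complex_of_real t \<in> h ` ball 1 \<rho>" by (rule subsetD)
  then obtain z1 where z1: "z1 \<in> ball 1 \<rho>" "h z1 = of_real t" by (elim imageE) simp
  have "complex_of_real t * \<omega> \<in> ball 0 \<epsilon>" using t \<omega>(2) by (simp add: norm_mult)
  with \<epsilon>(2) have "complex_of_real t * \<omega> \<in> h ` ball 1 \<rho>" by (rule subsetD)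
  then obtain z2 where z2: "z2 \<in> ball 1 \<rho>" "h z2 = of_real t * \<omega>" by (elim imageE) simp
  note z = z1 z2
  have cube: "cheb a z = 1 + h z ^ 3" if "z \<in> S" for z
  proof -
    have "?G z \<noteq> 0" using that by (auto simp: S_def)
    then have "exp (Ln (?G z) / 3) ^ 3 = ?G z"
      by (simp flip: exp_of_nat_mult)
    moreover have "quartic' a z \<noteq> 0" using that r_quartic' by (simp add: S_def)
    ultimately have "cheb a z - 1 = h z ^ 3"
      using cheb_minus_1[of a z] by (simp add: h_def power_mult_distrib)
    then show ?thesis by (simp only: diff_eq_eq add.commute)
  qed
  have zS: "z1 \<in> S" "z2 \<in> S" using z \<rho> by auto
  have val: "cheb a z1 = of_real (1 + t ^ 3)" "cheb a z2 = of_real (1 + t ^ 3)"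
    using cube[OF zS(1)] cube[OF zS(2)] z \<omega> by (simp_all add: power_mult_distrib)
  have "z1 \<notin> \<real> \<or> z2 \<notin> \<real>"
  proof (rule ccontr)
    assume "\<not> (z1 \<notin> \<real> \<or> z2 \<notin> \<real>)"
    then obtain x1 x2 where x: "z1 = of_real x1" "z2 = of_real x2" by (auto elim!: Reals_cases)
    have "dist (of_real 1) (complex_of_real x1) < r" "dist (of_real 1) (complex_of_real x2) < r"
      using zS by (auto simp: S_def x)
    then have "a1 < x1" "a1 < x2" using r unfolding dist_of_real by (auto simp: dist_real_def)
    moreover have "cheb a x1 = cheb a x2"
      using val unfolding x of_real_cheb[symmetric] of_real_eq_iff by simp
    ultimately have "x1 = x2" using cheb_strict_mono[of x1 x2] cheb_strict_mono[of x2 x1] by force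
    then have "of_real t = of_real t * \<omega>" using z x by simp
    then show False using t \<omega>(3) by simp
  qed
  moreover have "1 < 1 + t ^ 3" using t by simp
  ultimately show ?thesis
    using that[of z1 "1 + t ^ 3"] that[of z2 "1 + t ^ 3"] zS val unfolding S_def by blast
qed

text \<open>The closedness half of the continuation argument. The limit is not a pole because the
  values stay bounded, and not real because the map is locally injective at such a real point and
  commutes with conjugation.\<close>

lemma limit_of_nonreal_preimages:
  assumes z: "\<And>n. z n \<in> basin_component" "\<And>n. z n \<notin> \<real>" "\<And>n. cheb a (z n) = complex_of_real (w n)"
    and lim: "z \<longlonglongrightarrow> l" "w \<longlonglongrightarrow> v" and v: "1 < v"
  shows "l \<in> basin_component" "l \<notin> \<real>" "cheb a l = of_real v"
proof -
  have limw: "(\<lambda>n. cheb a (z n)) \<longlonglongrightarrow> of_real v"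
    unfolding z(3) by (intro tendsto_of_real lim)
  have nz: "quartic' a l \<noteq> 0"
  proof
    assume l: "quartic' a l = 0"
    have "z n \<noteq> l" for n using basin_quartic'[of "z n"] z(1) basin_component_subset_basin l by auto
    then have "filterlim z (at l) sequentially" using lim by (auto simp: filterlim_at)
    then have "filterlim (\<lambda>n. cheb a (z n)) at_infinity sequentially"
      by (rule filterlim_compose[OF cheb_pole[OF a l]])
    with limw show False
      using not_tendsto_and_filterlim_at_infinity[OF sequentially_bot] by blast
  qed
  have "(\<lambda>n. cheb a (z n)) \<longlonglongrightarrow> cheb a l"
    by (rule isCont_tendsto_compose[OF isCont_cheb[OF nz] lim(1)])
  with limw show val: "cheb a l = of_real v" by (rule LIMSEQ_unique[symmetric])
  \<comment> \<open>The value \<open>v\<close> exceeds 1 and hence \<open>a1\<close>, so it belongs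
    to the basin, and so does its preimage \<open>l\<close>.\<close>
  have "l \<in> basin" using basin_preimage[OF nz] real_in_basin[of v] val v a1(3) by simp
  moreover have "l \<in> closure basin_component" using z(1) lim(1) unfolding closure_sequential by (intro exI[of _ z]) simp
  ultimately show "l \<in> basin_component" by (intro basin_component_closed_in_basin)
  show "l \<notin> \<real>"
  proof
    assume "l \<in> \<real>"
    then obtain x where x: "l = of_real x" by (auto elim: Reals_cases)
    have nzx: "quartic' a x \<noteq> 0" using nz unfolding x of_real_quartic'[symmetric] by simp
    have "cheb a x = v" using val unfolding x of_real_cheb[symmetric] by simp
    \<comment> \<open>A root is fixed by the map, so it would equal \<open>v > 1\<close>; but the
      squares of the roots are 1 and \<open>a\<close>.\<close>
    have "quartic a x \<noteq> 0"
    proof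
      assume 0: "quartic a x = 0"
      then have "x = v" using \<open>cheb a x = v\<close> cheb_eq[OF nzx] by simp
      then have "1 < x\<^sup>2" using v by (simp add: power_gt1_lemma one_less_power)
      then show False using 0 a by (auto simp: quartic_def)
    qed
    have "x \<noteq> 0" using nzx by (auto simp: quartic'_def)
    have "0 < 12 * x^4 + (4 * x\<^sup>2 - of_real (1 + a))\<^sup>2"
      using \<open>x \<noteq> 0\<close> by (intro add_pos_nonneg) auto
    then have "6 * (quartic a x)\<^sup>2 * (12 * x^4 + (4 * x\<^sup>2 - of_real (1 + a))\<^sup>2) / quartic' a x ^ 4 \<noteq> 0"
      using \<open>quartic a x \<noteq> 0\<close> nzx by (simp only: divide_eq_0_iff mult_eq_0_iff) simp
    moreover have "deriv (cheb a) l = of_real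
        (6 * (quartic a x)\<^sup>2 * (12 * x^4 + (4 * x\<^sup>2 - of_real (1 + a))\<^sup>2) / quartic' a x ^ 4)"
      unfolding x DERIV_imp_deriv[OF DERIV_cheb[OF nz[unfolded x]]] by (simp add: of_real_quartic of_real_quartic')
    ultimately have "deriv (cheb a) l \<noteq> 0" by (simp only: of_real_eq_0_iff not_False_eq_True)
    from has_complex_derivative_locally_injective[OF holomorphic_cheb _ open_quartic'_nonzero this] nz
    obtain \<rho> where \<rho>: "0 < \<rho>" "inj_on (cheb a) (ball l \<rho>)" by auto
    have "\<forall>\<^sub>F n in sequentially. z n \<in> ball l \<rho>"
      using tendstoD[OF lim(1) \<rho>(1)] by (simp add: dist_commute)
    then obtain n where n: "z n \<in> ball l \<rho>" by (auto simp: eventually_sequentially)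
    \<comment> \<open>A disc with real centre is invariant under conjugation, so it contains both
      \<open>z n\<close> and its conjugate, which have the same image.\<close>
    have "dist l (cnj (z n)) = dist l (z n)"
      unfolding x dist_norm by (metis complex_cnj_complex_of_real complex_cnj_diff complex_mod_cnj)
    then have "cnj (z n) \<in> ball l \<rho>" using n by simp
    moreover have "cheb a (cnj (z n)) = cheb a (z n)"
      unfolding cnj_cheb[symmetric] z(3) by simp
    ultimately have "cnj (z n) = z n" using \<rho>(2) n by (auto dest: inj_onD)
    then show False using z(2)[of n] by (simp add: Reals_cnj_iff)
  qed
qed

text \<open>The values with a non-real preimage in the component form a nonempty, relatively open
  and closed subset of the connected ray above 1.\<close>

lemma nonreal_preimage:
  assumes "1 < w" shows "\<exists>z\<in>basin_component. z \<notin> \<real> \<and> cheb a z = complex_of_real w"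
proof -
  define D where "D = {1<..} \<inter> complex_of_real -` (cheb a ` (basin_component - \<real>))"
  have "open (cheb a ` (basin_component - \<real>))"
  proof (rule open_mapping_thm[OF holomorphic_cheb])
    show "open {z::complex. quartic' a z \<noteq> 0}" by (rule open_quartic'_nonzero)
    \<comment> \<open>The open mapping theorem asks for a connected domain; here it is the plane
      without finitely many points.\<close>
    have "connected (UNIV - {z::complex. quartic' a z = 0})"
      by (rule connected_open_delete_finite) (use finite_quartic'_zeros[OF a(2)] in auto)
    then show "connected {z::complex. quartic' a z \<noteq> 0}"
      by (simp add: Diff_eq Compl_eq)
    show "open (basin_component - \<real>)" using open_basin_component closed_complex_Reals by (rule open_Diff)
    show "basin_component - \<real> \<subseteq> {z. quartic' a z \<noteq> 0}" using basin_component_subset_basin basin_quartic' by auto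
    have 1: "quartic' a (1::complex) \<noteq> 0" using basin_quartic' one_in_basin by blast
    have c1: "cheb a (1::complex) = 1" using cheb_minus_1[OF 1] by simp
    \<comment> \<open>By oddness the map takes the distinct values 1 and -1 at the roots 1 and
      -1.\<close>
    show "\<not> cheb a constant_on {z::complex. quartic' a z \<noteq> 0}"
    proof
      assume "cheb a constant_on {z::complex. quartic' a z \<noteq> 0}"
      then have "cheb a (1::complex) = cheb a (- 1)"
        using 1 by (auto simp: constant_on_def quartic'_minus)
      then show False by (simp add: cheb_minus c1)
    qed
  qed
  then have "open (complex_of_real -` (cheb a ` (basin_component - \<real>)))"
    by (rule open_vimage) (intro continuous_intros)
  then have "openin (top_of_set {1<..}) D"
    unfolding D_def by (rule openin_open_Int)
  moreover have "D = {1<..} \<inter> closure D"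
  proof (intro subset_antisym subsetI)
    fix v assume "v \<in> {1<..} \<inter> closure D"
    then obtain u where u: "\<And>n. u n \<in> D" "u \<longlonglongrightarrow> v" and v: "1 < v"
      by (auto simp: closure_sequential)
    have "\<exists>z. z \<in> basin_component \<and> z \<notin> \<real> \<and> cheb a z = complex_of_real (u n)" for n
    proof -
      have "complex_of_real (u n) \<in> cheb a ` (basin_component - \<real>)" using u(1)[of n] by (simp add: D_def)
      then obtain z where "z \<in> basin_component - \<real>" "complex_of_real (u n) = cheb a z" by blast
      then show ?thesis by (intro exI[of _ z]) simp
    qed
    then have "\<exists>z. \<forall>n. z n \<in> basin_component \<and> z n \<notin> \<real> \<and> cheb a (z n) = complex_of_real (u n)"
      by (intro choice allI)
    then obtain z where z: "\<And>n. z n \<in> basin_component" "\<And>n. z n \<notin> \<real>" "\<And>n. cheb a (z n) = complex_of_real (u n)"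
      by blast
    obtain M where M: "\<And>n. norm (u n) \<le> M"
      using convergent_imp_Bseq[OF convergentI[OF u(2)]] by (auto simp: Bseq_def)
    \<comment> \<open>Since the map tends to infinity at infinity, preimages of the bounded values
      \<open>u n\<close> are bounded and a subsequence converges.\<close>
    have "\<forall>\<^sub>F z in at_infinity. M + 1 \<le> cmod (cheb a z)"
      using filterlim_at_infinity_imp_norm_at_top[OF filterlim_cheb_at_infinity[of a]]
      by (simp add: filterlim_at_top)
    then obtain B where B: "\<And>z. B \<le> cmod z \<Longrightarrow> M + 1 \<le> cmod (cheb a z)"
      by (auto simp: eventually_at_infinity)
    have "z n \<in> cball 0 B" for n
    proof (rule ccontr)
      assume "z n \<notin> cball 0 B"
      then have "M + 1 \<le> cmod (cheb a (z n))" by (intro B) simp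
      then show False using M[of n] unfolding z(3) by simp
    qed
    then obtain l s where l: "strict_mono (s :: nat \<Rightarrow> nat)" "(z \<circ> s) \<longlonglongrightarrow> l"
      using compact_cball[of 0 B] unfolding compact_def by metis
    have "l \<in> basin_component" "l \<notin> \<real>" "cheb a l = of_real v"
      using limit_of_nonreal_preimages[of "z \<circ> s" "u \<circ> s" l v] z l v
        LIMSEQ_subseq_LIMSEQ[OF u(2) l(1)] by auto
    then show "v \<in> D" using v unfolding D_def by (auto intro!: image_eqI[of _ _ l])
  next
    fix v assume "v \<in> D"
    then show "v \<in> {1<..} \<inter> closure D" using closure_subset[of D] by (simp add: subset_iff) (simp add: D_def)
  qed
  then have "closedin (top_of_set {1<..}) D"
    by (metis closed_closure closedin_closed_Int)
  moreover have "D \<noteq> {}"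
  proof -
    obtain z t where "z \<in> ball 1 r" "z \<notin> \<real>" "1 < t" "cheb a z = complex_of_real t"
      by (rule nonreal_preimage_near_1)
    then have "t \<in> D" using ball_subset_basin_component unfolding D_def by (auto intro!: image_eqI[of _ _ z])
    then show ?thesis by blast
  qed
  ultimately have "D = {1<..}"
    using connected_Ioi[of "1::real"] unfolding connected_clopen by blast
  then have "w \<in> D" using assms by simp
  then show ?thesis by (auto simp: D_def)
qed

text \<open>Take non-real preimages of reals tending to infinity. A preimage of large modulus would
  coincide with its conjugate by injectivity near infinity, so they are bounded; at an accumulation
  point the map cannot be continuous as a finite-valued function.\<close>

lemma pole_in_closure_basin_component: "\<exists>z \<in> closure basin_component. quartic' a z = 0"
proof -
  \<comment> \<open>The shift by 2 makes every value exceed 1, including the one for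
    \<open>n = 0\<close>.\<close>
  have "\<exists>z. \<forall>n. z n \<in> basin_component \<and> z n \<notin> \<real> \<and> cheb a (z n) = complex_of_real (real n + 2)"
    using nonreal_preimage[of "real _ + 2"] by (intro choice allI) auto
  then obtain z where z: "\<And>n. z n \<in> basin_component" "\<And>n. z n \<notin> \<real>"
    "\<And>n. cheb a (z n) = complex_of_real (real n + 2)" by blast
  obtain R where R: "\<And>z w. R < cmod z \<Longrightarrow> R < cmod w \<Longrightarrow> cheb a z = cheb a w \<Longrightarrow> z = w"
    using cheb_inj_near_infinity[of a] by metis
  have "z n \<in> cball 0 R" for n
  proof (rule ccontr)
    assume "z n \<notin> cball 0 R"
    then have "R < cmod (z n)" by simp
    moreover have "cheb a (cnj (z n)) = cheb a (z n)"
      unfolding cnj_cheb[symmetric] z(3) by simp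
    ultimately have "cnj (z n) = z n" using R[of "cnj (z n)" "z n"] by simp
    then show False using z(2)[of n] by (simp add: Reals_cnj_iff)
  qed
  then obtain l s where l: "strict_mono (s :: nat \<Rightarrow> nat)" "(z \<circ> s) \<longlonglongrightarrow> l"
    using compact_cball[of 0 R] unfolding compact_def by metis
  have "l \<in> closure basin_component"
    unfolding closure_sequential using l(2) by (intro exI[of _ "z \<circ> s"] conjI allI) (simp_all only: comp_apply z(1))
  moreover have "quartic' a l = 0"
  proof (rule ccontr)
    assume "quartic' a l \<noteq> 0"
    then have "(\<lambda>n. cheb a ((z \<circ> s) n)) \<longlonglongrightarrow> cheb a l"
      by (intro isCont_tendsto_compose[OF _ l(2)] isCont_cheb)
    moreover have "filterlim (\<lambda>n. cheb a ((z \<circ> s) n)) at_infinity sequentially"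
    proof -
      have "filterlim (\<lambda>n. real n + 2) at_top sequentially" by real_asymp
      then have "filterlim (\<lambda>n. complex_of_real (real n + 2)) at_infinity sequentially"
        by (rule filterlim_compose[OF filterlim_of_real_at_infinity])
      from filterlim_compose[OF this filterlim_subseq[OF l(1)]]
      show ?thesis by (simp add: z(3))
    qed
    ultimately show False
      using not_tendsto_and_filterlim_at_infinity[OF sequentially_bot] by blast
  qed
  ultimately show ?thesis by blast
qed

end

text \<open>One factor \<open>z - 1\<close> of the cubic contact is kept; the remaining factor
  vanishes at 1, so it is below 1/2 in modulus on a small disc.\<close>

lemma (in chebyshev_real) chebyshev_basin_exists: "\<exists>r. chebyshev_basin a a1 r"
proof -
  have 1: "quartic' a (1::complex) \<noteq> 0"
    using quartic'_pos[of 1] a1 of_real_quartic'[of a 1, where 'a = complex] by auto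
  have "isCont (\<lambda>z::complex. (z - 1)\<^sup>2 * cheb_cofactor a z) 1"
    unfolding cheb_cofactor_def Let_def
    by (intro continuous_intros isCont_quartic') (use 1 in simp)
  then have "((\<lambda>z::complex. (z - 1)\<^sup>2 * cheb_cofactor a z) \<longlongrightarrow> 0) (nhds 1)"
    using tendsto_at_iff_tendsto_nhds[of "\<lambda>z::complex. (z - 1)\<^sup>2 * cheb_cofactor a z" 1]
    by (simp add: isCont_def)
  from tendstoD[OF this, of "1 / 2"]
  have "\<forall>\<^sub>F z in nhds 1. norm ((z - 1)\<^sup>2 * cheb_cofactor a z :: complex) < 1 / 2" by simp
  moreover have "\<forall>\<^sub>F z in nhds (1::complex). z \<in> {z. quartic' a z \<noteq> 0}"
    by (rule eventually_nhds_in_open[OF open_quartic'_nonzero]) (use 1 in simp)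
  ultimately have "\<forall>\<^sub>F z in nhds (1::complex). norm ((z - 1)\<^sup>2 * cheb_cofactor a z) < 1 / 2 \<and> quartic' a z \<noteq> 0"
    by eventually_elim simp
  then obtain d where d: "0 < d"
    "\<And>z::complex. dist z 1 < d \<Longrightarrow> norm ((z - 1)\<^sup>2 * cheb_cofactor a z) < 1 / 2 \<and> quartic' a z \<noteq> 0"
    unfolding eventually_nhds_metric by blast
  have "chebyshev_basin a a1 (min d (1 - a1))"
  proof
    show "0 < min d (1 - a1)" "min d (1 - a1) \<le> 1 - a1" using d(1) a1 by auto
    fix z :: complex assume "z \<in> ball 1 (min d (1 - a1))"
    then have z: "norm ((z - 1)\<^sup>2 * cheb_cofactor a z) < 1 / 2" "quartic' a z \<noteq> 0"
      using d(2)[of z] by (auto simp: dist_commute)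
    show "quartic' a z \<noteq> 0" by (rule z(2))
    have "cheb a z - 1 = ((z - 1)\<^sup>2 * cheb_cofactor a z) * (z - 1)"
      unfolding cheb_minus_1[OF z(2)] by (simp add: power2_eq_square power3_eq_cube)
    then have "norm (cheb a z - 1) = norm ((z - 1)\<^sup>2 * cheb_cofactor a z) * norm (z - 1)"
      by (simp only: norm_mult)
    also have "\<dots> \<le> 1 / 2 * norm (z - 1)"
      using z(1) by (intro mult_right_mono) auto
    finally show "dist 1 (cheb a z) \<le> dist 1 z / 2"
      by (simp add: dist_norm norm_minus_commute)
  qed
  then show ?thesis ..
qed

section \<open>Symmetry\<close>

lemma fatou_set_isometry:
  fixes f s :: "'a::metric_space \<Rightarrow> 'a"
  assumes iso: "\<And>x y. dist (s x) (s y) = dist x y" and inv: "\<And>x. s (s x) = x"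
    and comm: "\<And>x. f (s x) = s (f x)" and x: "x \<in> fatou_set f"
  shows "s x \<in> fatou_set f"
proof -
  obtain U where U: "open U" "x \<in> U" "normal_family (range (\<lambda>n. f ^^ n)) U"
    using x by (auto simp: fatou_set_def)
  have cont: "continuous_on S s" for S
    by (rule continuous_on_iff[THEN iffD2]) (auto simp: iso)
  have image: "s ` S = s -` S" for S
    using inv by (auto intro: image_eqI[of _ _ "s _"])
  have pow: "(f ^^ n) (s y) = s ((f ^^ n) y)" for n y
    by (induction n) (auto simp: comm)
  have "normal_family (range (\<lambda>n. f ^^ n)) (s ` U)"
    unfolding normal_family_def
  proof (intro allI impI)
    fix F :: "nat \<Rightarrow> 'a \<Rightarrow> 'a" assume F: "range F \<subseteq> range (\<lambda>n. f ^^ n)"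
    have Fs: "F n (s y) = s (F n y)" for n y
    proof -
      obtain k where "F n = f ^^ k" using F by blast
      then show ?thesis by (simp add: pow)
    qed
    obtain r g where r: "strict_mono r"
      and g: "\<And>K. compact K \<Longrightarrow> K \<subseteq> U \<Longrightarrow> uniform_limit K (\<lambda>n. F (r n)) g sequentially"
      using U(3) F unfolding normal_family_def by meson
    have "uniform_limit K (\<lambda>n. F (r n)) (\<lambda>y. s (g (s y))) sequentially"
      if "compact K" "K \<subseteq> s ` U" for K
    proof (rule uniform_limitI)
      fix e :: real assume "0 < e"
      have "compact (s ` K)" using that cont by (intro compact_continuous_image)
      moreover have "s ` K \<subseteq> U" using that(2) inv by auto
      ultimately have "uniform_limit (s ` K) (\<lambda>n. F (r n)) g sequentially" by (rule g)
      from uniform_limitD[OF this \<open>0 < e\<close>]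
      show "\<forall>\<^sub>F n in sequentially. \<forall>y\<in>K. dist (F (r n) y) (s (g (s y))) < e"
      proof eventually_elim
        case (elim n)
        have "dist (F (r n) y) (s (g (s y))) = dist (F (r n) (s y)) (g (s y))" for y
          using iso[of "F (r n) (s y)" "g (s y)"] Fs[of "r n" "s y"] by (simp add: inv)
        with elim show ?case by auto
      qed
    qed
    then show "\<exists>r g. strict_mono r \<and>
        (\<forall>K. compact K \<and> K \<subseteq> s ` U \<longrightarrow> uniform_limit K (\<lambda>n. F (r n)) g sequentially)"
      using r by blast
  qed
  moreover have "open (s ` U)"
    unfolding image by (rule open_vimage[OF U(1) cont])
  moreover have "s x \<in> s ` U" using U(2) by simp
  ultimately show ?thesis
    unfolding fatou_set_def by (intro CollectI exI[of _ "s ` U"] conjI)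
qed

lemma immediate_basin_isometry:
  fixes f s :: "'a::metric_space \<Rightarrow> 'a"
  assumes iso: "\<And>x y. dist (s x) (s y) = dist x y" and inv: "\<And>x. s (s x) = x"
    and comm: "\<And>x. f (s x) = s (f x)" and y: "y \<in> immediate_basin f x"
  shows "s y \<in> immediate_basin f (s x)"
proof -
  obtain T where T: "connected T" "T \<subseteq> fatou_set f" "x \<in> T" "y \<in> T"
    using y by (auto simp: immediate_basin_def connected_component_def)
  have "continuous_on T s"
    by (rule continuous_on_iff[THEN iffD2]) (auto simp: iso)
  then have "connected (s ` T)" using T(1) by (intro connected_continuous_image)
  moreover have "s ` T \<subseteq> fatou_set f"
    using T(2) fatou_set_isometry[where s = s and f = f, OF iso inv comm] by auto
  ultimately show ?thesis
    unfolding immediate_basin_def connected_component_def mem_Collect_eq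
    using T(3,4) by (intro exI[of _ "s ` T"]) auto
qed

fun sphere_uminus :: "riemann_sphere \<Rightarrow> riemann_sphere" where
  "sphere_uminus (Fin z) = Fin (- z)"
| "sphere_uminus Infty = Infty"

lemma sphere_uminus_uminus: "sphere_uminus (sphere_uminus x) = x"
  by (cases x) auto

text \<open>On the sphere, \<open>z \<mapsto> - z\<close> is the half turn about the vertical axis,
  hence a chordal isometry.\<close>

lemma dist_sphere_uminus: "dist (sphere_uminus x) (sphere_uminus y) = dist x y"
proof -
  have "stereo (sphere_uminus x) = (- fst (stereo x), snd (stereo x))" for x
    by (cases x) auto
  then show ?thesis
    by (simp add: dist_riemann_sphere_def dist_prod_def dist_minus)
qed

context chebyshev_basin
begin

lemma C_sphere_uminus: "C (sphere_uminus x) = sphere_uminus (C x)"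
proof (cases x)
  case (Fin z)
  then show ?thesis
    by (cases "quartic' a z = 0")
      (simp_all add: chebyshev_method_Fin chebyshev_method_pole a quartic'_minus cheb_minus)
qed (simp add: chebyshev_method_Infty)

text \<open>The sign \<open>s\<close> treats both roots at once: all assertions are proved for the
  root 1 and carried over by \<open>\<sigma>\<close>, the identity or the half turn.\<close>

lemma immediate_basin_properties:
  assumes s: "s = 1 \<or> s = -1"
  shows "(\<lambda>x. Fin (of_real (s * x))) ` {a1<..} \<subseteq> immediate_basin C (Fin (of_real s))"
    and "\<not> bounded {z. Fin z \<in> immediate_basin C (Fin (of_real s))}"
    and "\<exists>z \<in> poles C. Fin z \<in> frontier (immediate_basin C (Fin (of_real s)))"
proof -
  define \<sigma> where "\<sigma> = (if s = 1 then id else sphere_uminus)"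
  have \<sigma>: "\<And>x y. dist (\<sigma> x) (\<sigma> y) = dist x y" "\<And>x. \<sigma> (\<sigma> x) = x" "\<And>x. C (\<sigma> x) = \<sigma> (C x)"
    by (auto simp: \<sigma>_def dist_sphere_uminus sphere_uminus_uminus C_sphere_uminus)
  have \<sigma>_Fin: "\<sigma> (Fin z) = Fin (of_real s * z)" for z
    using s by (auto simp: \<sigma>_def)
  let ?B = "immediate_basin C (Fin (of_real s))"
  have basin_component: "Fin (of_real s * z) \<in> ?B" if "z \<in> basin_component" for z
    using immediate_basin_isometry[where s = \<sigma> and f = C, OF \<sigma>, of "Fin z" "Fin 1"] basin_component_subset_immediate_basin that
    by (auto simp: \<sigma>_Fin)
  show ray: "(\<lambda>x. Fin (of_real (s * x))) ` {a1<..} \<subseteq> ?B"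
    using basin_component ray_subset_basin_component by auto
  show "\<not> bounded {z. Fin z \<in> ?B}"
  proof
    assume "bounded {z. Fin z \<in> ?B}"
    then obtain M where M: "\<And>z. Fin z \<in> ?B \<Longrightarrow> cmod z \<le> M"
      by (auto simp: bounded_iff)
    \<comment> \<open>A point of the ray whose modulus is larger than both \<open>a1\<close> and the
      supposed bound.\<close>
    have "cmod (of_real (s * (max a1 M + 1))) \<le> M"
      by (intro M subsetD[OF ray] image_eqI[OF refl]) auto
    moreover have "cmod (of_real (s * (max a1 M + 1))) = max a1 M + 1"
      unfolding norm_of_real abs_mult using s a1(2) by auto
    ultimately show False by simp
  qed
  obtain z where z: "z \<in> closure basin_component" "quartic' a z = 0" using pole_in_closure_basin_component by blast
  obtain x where x: "\<And>n. x n \<in> basin_component" "x \<longlonglongrightarrow> z"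
    using z(1) by (auto simp: closure_sequential)
  have "(\<lambda>n. Fin (of_real s * x n)) \<longlonglongrightarrow> Fin (of_real s * z)"
    using x(2) by (simp add: tendsto_Fin_iff tendsto_intros)
  then have "Fin (of_real s * z) \<in> closure ?B"
    unfolding closure_sequential using basin_component x(1) by (intro exI[of _ "\<lambda>n. Fin (of_real s * x n)"]) auto
  moreover have "Fin (of_real s * z) \<notin> ?B"
  proof
    assume "Fin (of_real s * z) \<in> ?B"
    then have "\<sigma> (Fin z) \<in> fatou_set C"
      using connected_component_subset[of "fatou_set C"] by (auto simp: immediate_basin_def \<sigma>_Fin)
    \<comment> \<open>Applying the involution again brings the pole back to \<open>z\<close>, where
      \<open>pole_not_in_fatou_set\<close> applies.\<close>
    then have "\<sigma> (\<sigma> (Fin z)) \<in> fatou_set C" by (rule fatou_set_isometry[where s = \<sigma> and f = C, OF \<sigma>])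
    then show False using pole_not_in_fatou_set[OF z(2,1)] by (simp add: \<sigma>)
  qed
  then have "Fin (of_real s * z) \<notin> interior ?B" using interior_subset by blast
  ultimately have "Fin (of_real s * z) \<in> frontier ?B" by (simp add: frontier_def)
  moreover have "quartic' a (of_real s * z) = 0" using z(2) s by (auto simp: quartic'_minus)
  then have "of_real s * z \<in> poles C"
    using a by (simp add: poles_def chebyshev_method_pole)
  ultimately show "\<exists>z \<in> poles C. Fin z \<in> frontier ?B" by blast
qed

end

theorem theorem3p6:
  fixes a a1 :: real and C :: "riemann_sphere \<Rightarrow> riemann_sphere"
  assumes "0 < a" and "a < 1"
    and C_def: "C = chebyshev_method (p_poly a)"
    and "0 < a1"
    and "complex_of_real a1 \<in> extraneous_fixed_points (p_poly a)"
    and "\<And>x::real. 0 < x \<Longrightarrow> complex_of_real x \<in> extraneous_fixed_points (p_poly a) \<Longrightarrow> x \<le> a1"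
  shows "(\<lambda>x. Fin (complex_of_real x)) ` {..< - a1} \<subseteq> immediate_basin C (Fin (- 1))
       \<and> (\<lambda>x. Fin (complex_of_real x)) ` {a1 <..} \<subseteq> immediate_basin C (Fin 1)
       \<and> \<not> bounded {z. Fin z \<in> immediate_basin C (Fin (- 1))}
       \<and> \<not> bounded {z. Fin z \<in> immediate_basin C (Fin 1)}
       \<and> (\<exists>z \<in> poles C. Fin z \<in> frontier (immediate_basin C (Fin (- 1))))
       \<and> (\<exists>z \<in> poles C. Fin z \<in> frontier (immediate_basin C (Fin 1)))"
proof -
  interpret chebyshev_real a a1
    using assms by (intro chebyshev_realI) auto
  obtain r where "chebyshev_basin a a1 r" using chebyshev_basin_exists by blast
  then interpret chebyshev_basin a a1 r .
  have "(\<lambda>x. Fin (complex_of_real x)) ` {..< - a1} \<subseteq> immediate_basin C (Fin (- 1))"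
  proof clarify
    fix x assume "x < - a1"
    then show "Fin (complex_of_real x) \<in> immediate_basin C (Fin (- 1))"
      using immediate_basin_properties(1)[of "- 1"] unfolding C_def
      by (auto dest!: subsetD[of _ _ "Fin (complex_of_real x)"] intro: image_eqI[of _ _ "- x"])
  qed
  then show ?thesis
    using immediate_basin_properties[of 1] immediate_basin_properties[of "- 1"]
    unfolding C_def by simp
qed

end
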